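(* Let $(M,\omega)$ be a compact Vaisman manifold with pointwise nonpositive constant (Chern) holomorphic sectional curvature, i.e. there is a function $c:M\to(-\infty,0]$ such that $H(X)=c(p)$ for every $p\in M$ and every nonzero $X\in T^{1,0}_pM$. Then $(M,\omega)$ is Kähler, i.e. $d\omega=0$.
   Context: A Hermitian manifold $(M,\omega)$ is a complex manifold, of complex dimension $n\ge 2$, with Hermitian metric $h$, $\omega=\sqrt{-1}\,h_{i\bar j}dz^i\wedge d\bar z^j$ in local holomorphic coordinates. The Chern connection has Christoffel symbols $\Gamma_{ij}^k=h^{k\bar l}\partial_i h_{j\bar l}$ and curvature $R_{i\bar jk\bar l}=-h_{p\bar l}\,\partial_{\bar j}\Gamma^p_{ik}$. The holomorphic sectional curvature is $H(X)=R(X,\bar X,X,\bar X)/|X|^4$ for nonzero $X=X^i\frac{\partial}{\partial z^i}\in T^{1,0}_pM$, where $R(X,\bar X,X,\bar X)=R_{i\bar jk\bar l}X^i\overline{X^j}X^k\overline{X^l}$ and $|X|^2=h_{i\bar j}X^i\overline{X^j}$. $(M,\omega)$ is locally conformal Kähler if $d\omega=\theta\wedge\omega$ for a closed real 1-form $\theta$ (the Lee form). It is Vaisman if it is locally conformal Kähler and $\theta$ is parallel with respect to the Levi-Civita connection of the Riemannian metric underlying $\omega$. *)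

theory Defs
  imports "HOL-Analysis.Analysis"
begin

section \<open>Smooth and holomorphic maps\<close>

text \<open>On open subsets of finite-dimensional spaces this is the usual class of
  \<open>k\<close> times continuously (real) differentiable maps: a map is of class \<open>Suc k\<close> iff it is
  differentiable and all its directional derivatives are of class \<open>k\<close>.\<close>

primrec ck_on :: "nat \<Rightarrow> ('v::real_normed_vector \<Rightarrow> 'w::real_normed_vector) \<Rightarrow> 'v set \<Rightarrow> bool" where
  "ck_on 0 f S \<longleftrightarrow> continuous_on S f"
| "ck_on (Suc k) f S \<longleftrightarrow>
     (\<forall>x\<in>S. f differentiable (at x)) \<and> (\<forall>v. ck_on k (\<lambda>x. frechet_derivative f (at x) v) S)"

definition smooth_on :: "'v set \<Rightarrow> ('v::real_normed_vector \<Rightarrow> 'w::real_normed_vector) \<Rightarrow> bool" where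
  "smooth_on S f \<longleftrightarrow> (\<forall>k. ck_on k f S)"

definition holomorphic_map_on :: "(complex^'n) set \<Rightarrow> (complex^'n \<Rightarrow> complex^'m) \<Rightarrow> bool" where
  "holomorphic_map_on S f \<longleftrightarrow>
     (\<forall>x\<in>S. \<exists>D. (f has_derivative D) (at x) \<and> (\<forall>a v. D (a *s v) = a *s D v))"


section \<open>Complex manifolds\<close>

text \<open>The underlying space of a manifold is a whole Hausdorff, second countable type \<open>'a\<close>.
  A chart is a pair of its domain and its coordinate map; the values of the coordinate map
  outside the domain are irrelevant.\<close>

type_synonym ('a, 'n) chart = "'a set \<times> ('a \<Rightarrow> complex^'n)"

definition coord_range :: "('a, 'n::finite) chart \<Rightarrow> (complex^'n) set" where
  "coord_range C = snd C ` fst C"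

definition transition :: "('a, 'n::finite) chart \<Rightarrow> ('a, 'n) chart \<Rightarrow> complex^'n \<Rightarrow> complex^'n" where
  "transition C D x = snd D (inv_into (fst C) (snd C) x)"

definition overlap :: "('a, 'n::finite) chart \<Rightarrow> ('a, 'n) chart \<Rightarrow> (complex^'n) set" where
  "overlap C D = snd C ` (fst C \<inter> fst D)"

definition complex_atlas ::
    "('a::{t2_space, second_countable_topology}, 'n::finite) chart set \<Rightarrow> bool" where
  "complex_atlas A \<longleftrightarrow>
     (\<Union>C\<in>A. fst C) = UNIV \<and>
     (\<forall>C\<in>A. open (fst C) \<and> open (coord_range C) \<and>
        (\<exists>\<psi>. homeomorphism (fst C) (coord_range C) (snd C) \<psi>)) \<and>
     (\<forall>C\<in>A. \<forall>D\<in>A. holomorphic_map_on (overlap C D) (transition C D))"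


section \<open>Hermitian metrics\<close>

text \<open>A tensor field is given by its components in every chart of the atlas, subject to the
  transformation law on overlaps. A real tangent vector is identified with the vector
  \<open>u \<in> \<complex>\<^sup>n\<close> for which it equals \<open>u\<^sup>i \<partial>/\<partial>z\<^sup>i + cnj u\<^sup>i \<partial>/\<partial>(cnj z\<^sup>i)\<close>, so that
  \<open>dz\<^sup>i(u) = u\<^sup>i\<close> and the complex structure is multiplication by \<open>\<i>\<close>; a vector of type (1,0) is
  identified with its components \<open>X\<^sup>i\<close>. Under both identifications vectors transform by the
  derivative of the transition map.\<close>

definition herm_form :: "complex^'n^'n \<Rightarrow> complex^'n \<Rightarrow> complex^'n \<Rightarrow> complex" where
  "herm_form H u v = (\<Sum>i\<in>UNIV. \<Sum>j\<in>UNIV. H $ i $ j * u $ i * cnj (v $ j))"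

definition pos_def_hermitian :: "complex^'n^'n \<Rightarrow> bool" where
  "pos_def_hermitian H \<longleftrightarrow>
     (\<forall>i j. H $ j $ i = cnj (H $ i $ j)) \<and> (\<forall>v. v \<noteq> 0 \<longrightarrow> 0 < Re (herm_form H v v))"

definition hermitian_metric ::
    "('a, 'n::finite) chart set \<Rightarrow> (('a, 'n) chart \<Rightarrow> complex^'n \<Rightarrow> complex^'n^'n) \<Rightarrow> bool" where
  "hermitian_metric A h \<longleftrightarrow>
     (\<forall>C\<in>A. smooth_on (coord_range C) (h C) \<and> (\<forall>x\<in>coord_range C. pos_def_hermitian (h C x))) \<and>
     (\<forall>C\<in>A. \<forall>D\<in>A. \<forall>x\<in>overlap C D. \<forall>u v.
        herm_form (h C x) u v =
        herm_form (h D (transition C D x))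
          (frechet_derivative (transition C D) (at x) u)
          (frechet_derivative (transition C D) (at x) v))"

text \<open>The value of \<open>\<i> h\<^sub>i\<^sub>j dz\<^sup>i \<and> d(cnj z\<^sup>j)\<close> on two real tangent vectors; the convention
  \<open>(\<alpha> \<and> \<beta>)(u, v) = \<alpha>(u) \<beta>(v) - \<alpha>(v) \<beta>(u)\<close> is used. For Hermitian \<open>H\<close> the number under
  \<open>Re\<close> is real.\<close>

definition fundamental_form :: "complex^'n^'n \<Rightarrow> complex^'n \<Rightarrow> complex^'n \<Rightarrow> real" where
  "fundamental_form H u v = Re (\<i> * (herm_form H u v - herm_form H v u))"

text \<open>\<open>g(u, v) = \<omega>(u, J v)\<close>\<close>

definition riemannian_metric :: "complex^'n^'n \<Rightarrow> complex^'n \<Rightarrow> complex^'n \<Rightarrow> real" where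
  "riemannian_metric H u v = fundamental_form H u (\<i> *s v)"


section \<open>Differential forms in coordinates\<close>

text \<open>Vectors \<open>u, v, w\<close> are extended to constant (hence commuting) coordinate vector fields.\<close>

definition ext_deriv1 :: "('v::real_normed_vector \<Rightarrow> 'v \<Rightarrow> real) \<Rightarrow> 'v \<Rightarrow> 'v \<Rightarrow> 'v \<Rightarrow> real" where
  "ext_deriv1 \<theta> x u v =
     frechet_derivative (\<lambda>y. \<theta> y v) (at x) u - frechet_derivative (\<lambda>y. \<theta> y u) (at x) v"

definition ext_deriv2 ::
    "('v::real_normed_vector \<Rightarrow> 'v \<Rightarrow> 'v \<Rightarrow> real) \<Rightarrow> 'v \<Rightarrow> 'v \<Rightarrow> 'v \<Rightarrow> 'v \<Rightarrow> real" where
  "ext_deriv2 \<omega> x u v w =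
     frechet_derivative (\<lambda>y. \<omega> y v w) (at x) u
     - frechet_derivative (\<lambda>y. \<omega> y u w) (at x) v
     + frechet_derivative (\<lambda>y. \<omega> y u v) (at x) w"

definition wedge12 :: "('v \<Rightarrow> real) \<Rightarrow> ('v \<Rightarrow> 'v \<Rightarrow> real) \<Rightarrow> 'v \<Rightarrow> 'v \<Rightarrow> 'v \<Rightarrow> real" where
  "wedge12 \<alpha> \<beta> u v w = \<alpha> u * \<beta> v w - \<alpha> v * \<beta> u w + \<alpha> w * \<beta> u v"

definition one_form ::
    "('a, 'n::finite) chart set \<Rightarrow> (('a, 'n) chart \<Rightarrow> complex^'n \<Rightarrow> complex^'n \<Rightarrow> real) \<Rightarrow> bool" where
  "one_form A \<theta> \<longleftrightarrow>
     (\<forall>C\<in>A. (\<forall>x\<in>coord_range C. linear (\<theta> C x)) \<and>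
            (\<forall>v. smooth_on (coord_range C) (\<lambda>x. \<theta> C x v))) \<and>
     (\<forall>C\<in>A. \<forall>D\<in>A. \<forall>x\<in>overlap C D. \<forall>v.
        \<theta> C x v = \<theta> D (transition C D x) (frechet_derivative (transition C D) (at x) v))"

definition closed_one_form ::
    "('a, 'n::finite) chart set \<Rightarrow> (('a, 'n) chart \<Rightarrow> complex^'n \<Rightarrow> complex^'n \<Rightarrow> real) \<Rightarrow> bool" where
  "closed_one_form A \<theta> \<longleftrightarrow>
     one_form A \<theta> \<and> (\<forall>C\<in>A. \<forall>x\<in>coord_range C. \<forall>u v. ext_deriv1 (\<theta> C) x u v = 0)"


section \<open>Levi-Civita connection\<close>

text \<open>\<open>\<Gamma> x u v\<close> is the value at \<open>x\<close> of the covariant derivative of the constant field \<open>v\<close> in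
  direction \<open>u\<close>. The conditions say that the connection is torsion-free and preserves \<open>g\<close>.\<close>

definition levi_civita_on ::
    "'v set \<Rightarrow> ('v::real_normed_vector \<Rightarrow> 'v \<Rightarrow> 'v \<Rightarrow> real) \<Rightarrow> ('v \<Rightarrow> 'v \<Rightarrow> 'v \<Rightarrow> 'v) \<Rightarrow> bool" where
  "levi_civita_on S g \<Gamma> \<longleftrightarrow>
     (\<forall>x\<in>S. bilinear (\<Gamma> x) \<and> (\<forall>u v. \<Gamma> x u v = \<Gamma> x v u) \<and>
        (\<forall>u v w. frechet_derivative (\<lambda>y. g y v w) (at x) u = g x (\<Gamma> x u v) w + g x v (\<Gamma> x u w)))"

definition parallel_on ::
    "'v set \<Rightarrow> ('v::real_normed_vector \<Rightarrow> 'v \<Rightarrow> 'v \<Rightarrow> 'v) \<Rightarrow> ('v \<Rightarrow> 'v \<Rightarrow> real) \<Rightarrow> bool" where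
  "parallel_on S \<Gamma> \<theta> \<longleftrightarrow>
     (\<forall>x\<in>S. \<forall>u v. frechet_derivative (\<lambda>y. \<theta> y v) (at x) u - \<theta> x (\<Gamma> x u v) = 0)"

lemma levi_civita_on_unique:
  assumes \<Gamma>: "levi_civita_on S g \<Gamma>" "levi_civita_on S g \<Gamma>'" and x: "x \<in> S"
    and g: "bilinear (g x)" "\<And>u v. g x u v = g x v u" "\<And>v. v \<noteq> 0 \<Longrightarrow> 0 < g x v v"
  shows "\<Gamma> x = \<Gamma>' x"
proof (intro ext)
  fix u v
  define B where "B a b = \<Gamma> x a b - \<Gamma>' x a b" for a b
  define K where "K a b d = g x (B a b) d" for a b d
  have "\<Gamma> x a b = \<Gamma> x b a" "\<Gamma>' x a b = \<Gamma>' x b a" for a b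
    using \<Gamma> x unfolding levi_civita_on_def by blast+
  then have sym: "K a b d = K b a d" for a b d
    unfolding K_def B_def by metis
  have skew: "K a b d = - K a d b" for a b d
  proof -
    have "frechet_derivative (\<lambda>y. g y b d) (at x) a = g x (\<Gamma> x a b) d + g x b (\<Gamma> x a d)"
      using \<Gamma>(1) x unfolding levi_civita_on_def by blast
    moreover have "frechet_derivative (\<lambda>y. g y b d) (at x) a = g x (\<Gamma>' x a b) d + g x b (\<Gamma>' x a d)"
      using \<Gamma>(2) x unfolding levi_civita_on_def by blast
    moreover have "g x b (\<Gamma> x a d) = g x (\<Gamma> x a d) b" "g x b (\<Gamma>' x a d) = g x (\<Gamma>' x a d) b"
      by (rule g(2))+
    ultimately show ?thesis
      unfolding K_def B_def bilinear_lsub[OF g(1)] by linarith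
  qed
  have "K a b d = 0" for a b d
    using sym[of a b d] skew[of b a d] sym[of b d a] skew[of d b a] sym[of d a b] skew[of a d b]
    by linarith
  then have "g x (B u v) (B u v) = 0"
    unfolding K_def by blast
  then have "B u v = 0"
    using g(3)[of "B u v"] by (metis less_irrefl)
  then show "\<Gamma> x u v = \<Gamma>' x u v"
    by (simp add: B_def)
qed


section \<open>Kaehler, locally conformal Kaehler and Vaisman metrics\<close>

definition kahler ::
    "('a, 'n::finite) chart set \<Rightarrow> (('a, 'n) chart \<Rightarrow> complex^'n \<Rightarrow> complex^'n^'n) \<Rightarrow> bool" where
  "kahler A h \<longleftrightarrow>
     (\<forall>C\<in>A. \<forall>x\<in>coord_range C. \<forall>u v w.
        ext_deriv2 (\<lambda>y. fundamental_form (h C y)) x u v w = 0)"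

definition lee_form ::
    "('a, 'n::finite) chart set \<Rightarrow> (('a, 'n) chart \<Rightarrow> complex^'n \<Rightarrow> complex^'n^'n) \<Rightarrow>
     (('a, 'n) chart \<Rightarrow> complex^'n \<Rightarrow> complex^'n \<Rightarrow> real) \<Rightarrow> bool" where
  "lee_form A h \<theta> \<longleftrightarrow>
     closed_one_form A \<theta> \<and>
     (\<forall>C\<in>A. \<forall>x\<in>coord_range C. \<forall>u v w.
        ext_deriv2 (\<lambda>y. fundamental_form (h C y)) x u v w =
        wedge12 (\<theta> C x) (fundamental_form (h C x)) u v w)"

definition vaisman ::
    "('a, 'n::finite) chart set \<Rightarrow> (('a, 'n) chart \<Rightarrow> complex^'n \<Rightarrow> complex^'n^'n) \<Rightarrow> bool" where
  "vaisman A h \<longleftrightarrow>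
     (\<exists>\<theta>. lee_form A h \<theta> \<and>
        (\<forall>C\<in>A. \<exists>\<Gamma>. levi_civita_on (coord_range C) (\<lambda>y. riemannian_metric (h C y)) \<Gamma> \<and>
                   parallel_on (coord_range C) \<Gamma> (\<theta> C)))"


section \<open>Chern connection and holomorphic sectional curvature\<close>

definition d_z :: "'n \<Rightarrow> (complex^'n \<Rightarrow> complex) \<Rightarrow> complex^'n \<Rightarrow> complex" where
  "d_z i f x = (frechet_derivative f (at x) (axis i 1) - \<i> * frechet_derivative f (at x) (axis i \<i>)) / 2"

definition d_zbar :: "'n \<Rightarrow> (complex^'n \<Rightarrow> complex) \<Rightarrow> complex^'n \<Rightarrow> complex" where
  "d_zbar i f x = (frechet_derivative f (at x) (axis i 1) + \<i> * frechet_derivative f (at x) (axis i \<i>)) / 2"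

text \<open>\<open>chern_gamma h i j k\<close> has the lower indices \<open>i, j\<close> and the upper index \<open>k\<close>. The entry
  of the inverse matrix with indices \<open>l, k\<close> is the inverse metric with upper indices \<open>k\<close> and
  \<open>l\<close>-bar, as \<open>\<Sum>l. h\<^sub>j\<^sub>l (matrix_inv h)\<^sub>l\<^sub>k = \<delta>\<^sub>j\<^sub>k\<close>.\<close>

definition chern_gamma :: "(complex^'n \<Rightarrow> complex^'n^'n) \<Rightarrow> 'n \<Rightarrow> 'n \<Rightarrow> 'n \<Rightarrow> complex^'n \<Rightarrow> complex" where
  "chern_gamma h i j k x = (\<Sum>l\<in>UNIV. matrix_inv (h x) $ l $ k * d_z i (\<lambda>y. h y $ j $ l) x)"

definition chern_curv ::
    "(complex^'n \<Rightarrow> complex^'n^'n) \<Rightarrow> 'n \<Rightarrow> 'n \<Rightarrow> 'n \<Rightarrow> 'n \<Rightarrow> complex^'n \<Rightarrow> complex" where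
  "chern_curv h i j k l x = - (\<Sum>p\<in>UNIV. h x $ p $ l * d_zbar j (chern_gamma h i k p) x)"

definition hol_sect_curv :: "(complex^'n \<Rightarrow> complex^'n^'n) \<Rightarrow> complex^'n \<Rightarrow> complex^'n \<Rightarrow> complex" where
  "hol_sect_curv h x X =
     (\<Sum>i\<in>UNIV. \<Sum>j\<in>UNIV. \<Sum>k\<in>UNIV. \<Sum>l\<in>UNIV.
        chern_curv h i j k l x * X $ i * cnj (X $ j) * X $ k * cnj (X $ l))
     / (herm_form (h x) X X)\<^sup>2"

end

theory Submission
  imports Defs
begin

text \<open>
  The argument is pointwise. Write \<open>\<eta>\<close> for the (1,0)-part of the Lee form, \<open>X\<close> for its metric dual and
  \<open>s = |X|\<^sup>2\<close>. Splitting \<open>d\<omega> = \<theta> \<and> \<omega>\<close> and \<open>\<nabla>\<theta> = 0\<close> by type gives the torsion of the Chern connection,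
  \<open>T(u, v) = \<eta>(u) v - \<eta>(v) u\<close>, and the two equations \<open>\<nabla>\<^sup>1\<^sup>,\<^sup>0 \<eta> = 0\<close> (Chern) and
  \<open>\<partial>bar \<eta> = \<beta>\<close> with \<open>\<beta>(v, w) = \<eta>(v) cnj (\<eta>(w)) - s h(v, w)\<close>.
  Commuting the two kinds of derivatives shows that \<open>s\<close> is constant and that
  \<open>K(u, w, v, z) = R(u, w, v, z) + h(v, z) \<beta>(u, w)\<close> vanishes as soon as one argument is \<open>X\<close>, while \<open>K\<close> has
  the symmetries of a Kaehler curvature tensor. If \<open>X \<noteq> 0\<close>, then \<open>K(X, X, X, X) = 0\<close> forces the holomorphic
  sectional curvature to be zero; comparing \<open>K\<close> on the diagonal at \<open>X + Z\<close> and at \<open>Z\<close>, with \<open>Z \<noteq> 0\<close>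
  orthogonal to \<open>X\<close>, then gives \<open>s\<^sup>2 |Z|\<^sup>2 = 0\<close>, a contradiction.
\<close>

section \<open>Smooth maps\<close>

lemma has_real_derivative_along_line:
  fixes f :: "'v::real_normed_vector \<Rightarrow> real"
  assumes "f differentiable (at (p + a *\<^sub>R u))"
  shows "((\<lambda>t. f (p + t *\<^sub>R u)) has_real_derivative frechet_derivative f (at (p + a *\<^sub>R u)) u) (at a)"
proof -
  let ?F = "frechet_derivative f (at (p + a *\<^sub>R u))"
  have "(f has_derivative ?F) (at (p + a *\<^sub>R u))"
    using assms by (simp add: frechet_derivative_works)
  moreover have "((\<lambda>t. p + t *\<^sub>R u) has_derivative (\<lambda>t. t *\<^sub>R u)) (at a)"
    by (auto intro!: derivative_eq_intros)
  ultimately have "((\<lambda>t. f (p + t *\<^sub>R u)) has_derivative (\<lambda>t. ?F (t *\<^sub>R u))) (at a)"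
    using has_derivative_compose[of "\<lambda>t. p + t *\<^sub>R u" _ a UNIV f ?F] by blast
  moreover have "?F (t *\<^sub>R u) = ?F u * t" for t
    using linear_frechet_derivative[OF assms] by (simp add: linear_cmul)
  ultimately show ?thesis
    by (simp add: has_field_derivative_def)
qed

text \<open>The mean value theorem is applied twice: in direction \<open>u\<close> to the difference
  of \<open>f\<close> along two parallel edges, then in direction \<open>v\<close> to the resulting
  difference of first derivatives.\<close>

lemma second_difference_mean_value:
  fixes f :: "'v::real_normed_vector \<Rightarrow> real"
  assumes f: "\<And>y. y \<in> S \<Longrightarrow> f differentiable (at y)"
    and Df: "\<And>y. y \<in> S \<Longrightarrow> (\<lambda>z. frechet_derivative f (at z) u) differentiable (at y)"
    and t: "t > 0"
    and S: "\<And>a b. 0 \<le> a \<Longrightarrow> a \<le> t \<Longrightarrow> 0 \<le> b \<Longrightarrow> b \<le> t \<Longrightarrow> x + a *\<^sub>R u + b *\<^sub>R v \<in> S"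
  obtains a b where "0 < a" "a < t" "0 < b" "b < t"
    and "f (x + t *\<^sub>R u + t *\<^sub>R v) - f (x + t *\<^sub>R u) - f (x + t *\<^sub>R v) + f x =
      t\<^sup>2 * frechet_derivative (\<lambda>z. frechet_derivative f (at z) u) (at (x + a *\<^sub>R u + b *\<^sub>R v)) v"
proof -
  let ?D = "\<lambda>z. frechet_derivative f (at z) u"
  define \<phi> where "\<phi> a = f ((x + t *\<^sub>R v) + a *\<^sub>R u) - f (x + a *\<^sub>R u)" for a
  have "(\<phi> has_real_derivative ?D ((x + t *\<^sub>R v) + a *\<^sub>R u) - ?D (x + a *\<^sub>R u)) (at a)"
    if "0 \<le> a" "a \<le> t" for a
  proof -
    have "(x + t *\<^sub>R v) + a *\<^sub>R u \<in> S" "x + a *\<^sub>R u \<in> S"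
      using S[of a t] S[of a 0] that t by (auto simp: algebra_simps)
    then show ?thesis
      unfolding \<phi>_def by (intro DERIV_diff has_real_derivative_along_line f)
  qed
  then obtain a where a: "0 < a" "a < t"
    and 1: "\<phi> t - \<phi> 0 = (t - 0) * (?D ((x + t *\<^sub>R v) + a *\<^sub>R u) - ?D (x + a *\<^sub>R u))"
    using MVT2[of 0 t \<phi> "\<lambda>a. ?D ((x + t *\<^sub>R v) + a *\<^sub>R u) - ?D (x + a *\<^sub>R u)"] t by blast
  have "((\<lambda>b. ?D ((x + a *\<^sub>R u) + b *\<^sub>R v)) has_real_derivative
      frechet_derivative ?D (at ((x + a *\<^sub>R u) + b *\<^sub>R v)) v) (at b)" if "0 \<le> b" "b \<le> t" for b
    using S[of a b] that a by (intro has_real_derivative_along_line Df) auto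
  then obtain b where b: "0 < b" "b < t"
    and 2: "?D ((x + a *\<^sub>R u) + t *\<^sub>R v) - ?D ((x + a *\<^sub>R u) + 0 *\<^sub>R v)
      = (t - 0) * frechet_derivative ?D (at ((x + a *\<^sub>R u) + b *\<^sub>R v)) v"
    using MVT2[of 0 t "\<lambda>b. ?D ((x + a *\<^sub>R u) + b *\<^sub>R v)"
        "\<lambda>b. frechet_derivative ?D (at ((x + a *\<^sub>R u) + b *\<^sub>R v)) v"] t by blast
  have "f (x + t *\<^sub>R u + t *\<^sub>R v) - f (x + t *\<^sub>R u) - f (x + t *\<^sub>R v) + f x = \<phi> t - \<phi> 0"
    by (simp add: \<phi>_def algebra_simps)
  also have "\<dots> = t\<^sup>2 * frechet_derivative ?D (at (x + a *\<^sub>R u + b *\<^sub>R v)) v"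
    using 1 2 by (simp add: algebra_simps power2_eq_square)
  finally show thesis
    using that a b by blast
qed

text \<open>The second difference of \<open>f\<close> over a parallelogram at \<open>x\<close> does
  not change when \<open>u\<close> and \<open>v\<close> are exchanged. Hence each mixed derivative
  attains the same value somewhere in the parallelogram, and continuity carries the equality to
  \<open>x\<close> as the parallelogram shrinks.\<close>

lemma symmetric_second_derivative:
  fixes f :: "'v::real_normed_vector \<Rightarrow> real"
  assumes S: "open S" "x \<in> S"
    and f: "\<And>y. y \<in> S \<Longrightarrow> f differentiable (at y)"
    and Df: "\<And>y w. y \<in> S \<Longrightarrow> (\<lambda>z. frechet_derivative f (at z) w) differentiable (at y)"
    and cont: "\<And>w w'. continuous_on S
      (\<lambda>y. frechet_derivative (\<lambda>z. frechet_derivative f (at z) w) (at y) w')"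
  shows "frechet_derivative (\<lambda>z. frechet_derivative f (at z) u) (at x) v =
    frechet_derivative (\<lambda>z. frechet_derivative f (at z) v) (at x) u" (is "?F x = ?G x")
proof (rule ccontr)
  assume neq: "?F x \<noteq> ?G x"
  \<comment> \<open>With half the distance, a number closer than \<open>e\<close> to both
    \<open>?F x\<close> and \<open>?G x\<close> contradicts the triangle inequality.\<close>
  define e where "e = dist (?F x) (?G x) / 2"
  have e: "e > 0" using neq by (simp add: e_def)
  have "isCont ?F x" "isCont ?G x"
    using cont S by (auto simp: continuous_on_eq_continuous_at)
  then obtain d1 d2 where d: "d1 > 0" "d2 > 0"
    and d1: "\<And>y. dist y x < d1 \<Longrightarrow> dist (?F y) (?F x) < e"
    and d2: "\<And>y. dist y x < d2 \<Longrightarrow> dist (?G y) (?G x) < e"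
    unfolding continuous_at_eps_delta using e by metis
  obtain d3 where d3: "d3 > 0" "ball x d3 \<subseteq> S"
    using S open_contains_ball by blast
  define d where "d = min d1 (min d2 d3)"
  \<comment> \<open>This size keeps the whole parallelogram within distance \<open>d\<close> of
    \<open>x\<close>; the summand 1 makes the denominator positive even for
    \<open>u = v = 0\<close>.\<close>
  define t where "t = d / (2 * (norm u + norm v + 1))"
  have n: "norm u + norm v + 1 > 0" by (smt (verit) norm_ge_zero)
  have t: "t > 0" using \<open>d1 > 0\<close> \<open>d2 > 0\<close> d3 n by (simp add: t_def d_def)
  have small: "dist (x + a *\<^sub>R u + b *\<^sub>R v) x < d"
    if "0 \<le> a" "a \<le> t" "0 \<le> b" "b \<le> t" for a b
  proof -
    have "dist (x + a *\<^sub>R u + b *\<^sub>R v) x \<le> a * norm u + b * norm v"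
      using norm_triangle_ineq[of "a *\<^sub>R u" "b *\<^sub>R v"] that by (simp add: dist_norm add.assoc)
    also have "\<dots> \<le> t * norm u + t * norm v"
      using that by (intro add_mono mult_right_mono) auto
    also have "\<dots> < t * (2 * (norm u + norm v + 1))"
      using t n by (simp add: distrib_left) (smt (verit) mult_nonneg_nonneg norm_ge_zero)
    also have "\<dots> = d" using n by (simp add: t_def)
    finally show ?thesis .
  qed
  have inS: "x + a *\<^sub>R u + b *\<^sub>R v \<in> S" "x + b *\<^sub>R v + a *\<^sub>R u \<in> S"
    if "0 \<le> a" "a \<le> t" "0 \<le> b" "b \<le> t" for a b
  proof -
    show "x + a *\<^sub>R u + b *\<^sub>R v \<in> S"
      using small[OF that] d3 by (auto simp: d_def dist_commute subset_iff)
    then show "x + b *\<^sub>R v + a *\<^sub>R u \<in> S"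
      by (metis add.assoc add.commute)
  qed
  obtain a b where ab: "0 < a" "a < t" "0 < b" "b < t" and
    1: "f (x + t *\<^sub>R u + t *\<^sub>R v) - f (x + t *\<^sub>R u) - f (x + t *\<^sub>R v) + f x =
      t\<^sup>2 * ?F (x + a *\<^sub>R u + b *\<^sub>R v)"
    by (rule second_difference_mean_value[OF f Df t inS(1)])
  obtain b' a' where ab': "0 < b'" "b' < t" "0 < a'" "a' < t" and
    2: "f (x + t *\<^sub>R v + t *\<^sub>R u) - f (x + t *\<^sub>R v) - f (x + t *\<^sub>R u) + f x =
      t\<^sup>2 * ?G (x + b' *\<^sub>R v + a' *\<^sub>R u)"
    by (rule second_difference_mean_value[OF f Df t inS(2)])
  have "t\<^sup>2 * ?F (x + a *\<^sub>R u + b *\<^sub>R v) = t\<^sup>2 * ?G (x + b' *\<^sub>R v + a' *\<^sub>R u)"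
    using 1 2 by (simp add: algebra_simps)
  then have eq: "?F (x + a *\<^sub>R u + b *\<^sub>R v) = ?G (x + b' *\<^sub>R v + a' *\<^sub>R u)"
    using t by simp
  have "dist (x + a *\<^sub>R u + b *\<^sub>R v) x < d1" "dist (x + b' *\<^sub>R v + a' *\<^sub>R u) x < d2"
    using small[of a b] small[of a' b'] ab ab' by (simp_all add: d_def algebra_simps)
  then have "dist (?F (x + a *\<^sub>R u + b *\<^sub>R v)) (?F x) < e"
    "dist (?F (x + a *\<^sub>R u + b *\<^sub>R v)) (?G x) < e"
    using d1 d2 eq by metis+
  then show False
    unfolding e_def by (metis dist_commute dist_triangle_half_r less_irrefl)
qed

section \<open>Closure properties of smooth maps\<close>

lemma ck_on_cong:
  assumes "open S" "\<And>x. x \<in> S \<Longrightarrow> f x = g x" "ck_on k f S"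
  shows "ck_on k g S"
  using assms(2,3)
proof (induction k arbitrary: f g)
  case 0
  then show ?case by (simp cong: continuous_on_cong)
next
  case (Suc k)
  \<comment> \<open>The derivative at a point depends on a full neighbourhood, which the open set
    \<open>S\<close> provides; so agreement on \<open>S\<close> passes to the derivatives and the
    induction can continue.\<close>
  have D: "(g has_derivative frechet_derivative f (at x)) (at x)" if "x \<in> S" for x
  proof (rule has_derivative_transform_within_open[OF _ assms(1) that])
    show "(f has_derivative frechet_derivative f (at x)) (at x)"
      using Suc.prems(2) that by (simp add: frechet_derivative_works)
  qed (rule Suc.prems(1))
  then have "frechet_derivative f (at x) v = frechet_derivative g (at x) v" if "x \<in> S" for x v
    using frechet_derivative_at[OF D[OF that]] by simp
  then have "ck_on k (\<lambda>x. frechet_derivative g (at x) v) S" for v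
    by (rule Suc.IH) (use Suc.prems(2) in auto)
  then show ?case
    using D by (auto simp: differentiable_def)
qed

lemma ck_on_bounded_linear:
  assumes "open S" and L: "bounded_linear L" and "ck_on k f S"
  shows "ck_on k (\<lambda>x. L (f x)) S"
  using assms(3)
proof (induction k arbitrary: f)
  case 0
  then show ?case
    using L by (simp add: bounded_linear.continuous_on)
next
  case (Suc k)
  have D: "((\<lambda>x. L (f x)) has_derivative (\<lambda>v. L (frechet_derivative f (at x) v))) (at x)"
    if "x \<in> S" for x
    using Suc.prems that L
    by (auto simp: frechet_derivative_works intro: bounded_linear.has_derivative)
  have eq: "L (frechet_derivative f (at x) v) = frechet_derivative (\<lambda>x. L (f x)) (at x) v"
    if "x \<in> S" for x v
    by (rule fun_cong[OF frechet_derivative_at[OF D[OF that]]])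
  have "ck_on k (\<lambda>x. frechet_derivative (\<lambda>x. L (f x)) (at x) v) S" for v
  proof (rule ck_on_cong[OF assms(1)])
    show "L (frechet_derivative f (at x) v) = frechet_derivative (\<lambda>x. L (f x)) (at x) v"
      if "x \<in> S" for x
      using that by (rule eq)
    show "ck_on k (\<lambda>x. L (frechet_derivative f (at x) v)) S"
      using Suc by auto
  qed
  then show ?case
    using D by (auto simp: differentiable_def)
qed

lemma ck_on_add:
  assumes "open S" and "ck_on k f S" and "ck_on k g S"
  shows "ck_on k (\<lambda>x. f x + g x) S"
  using assms(2,3)
proof (induction k arbitrary: f g)
  case 0
  then show ?case
    by (simp add: continuous_on_add)
next
  case (Suc k)
  have D: "((\<lambda>x. f x + g x) has_derivative
      (\<lambda>v. frechet_derivative f (at x) v + frechet_derivative g (at x) v)) (at x)"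
    if "x \<in> S" for x
    using Suc.prems that by (auto simp: frechet_derivative_works intro: has_derivative_add)
  have eq: "frechet_derivative f (at x) v + frechet_derivative g (at x) v
      = frechet_derivative (\<lambda>x. f x + g x) (at x) v" if "x \<in> S" for x v
    by (rule fun_cong[OF frechet_derivative_at[OF D[OF that]]])
  have "ck_on k (\<lambda>x. frechet_derivative (\<lambda>x. f x + g x) (at x) v) S" for v
  proof (rule ck_on_cong[OF assms(1)])
    show "frechet_derivative f (at x) v + frechet_derivative g (at x) v = frechet_derivative (\<lambda>x. f x + g x) (at x) v"
      if "x \<in> S" for x
      using that by (rule eq)
    show "ck_on k (\<lambda>x. frechet_derivative f (at x) v + frechet_derivative g (at x) v) S"
      using Suc by auto
  qed
  then show ?case
    using D by (auto simp: differentiable_def)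
qed

lemma smooth_on_bounded_linear:
  "open S \<Longrightarrow> bounded_linear L \<Longrightarrow> smooth_on S f \<Longrightarrow> smooth_on S (\<lambda>x. L (f x))"
  by (simp add: smooth_on_def ck_on_bounded_linear)

lemma smooth_on_add:
  "open S \<Longrightarrow> smooth_on S f \<Longrightarrow> smooth_on S g \<Longrightarrow> smooth_on S (\<lambda>x. f x + g x)"
  by (simp add: smooth_on_def ck_on_add)

lemma smooth_on_imp_differentiable: "smooth_on S f \<Longrightarrow> x \<in> S \<Longrightarrow> f differentiable (at x)"
  by (auto simp: smooth_on_def dest: spec[of _ "Suc 0"])

lemma smooth_on_imp_continuous_on: "smooth_on S f \<Longrightarrow> continuous_on S f"
  by (auto simp: smooth_on_def dest: spec[of _ 0])

lemma smooth_on_frechet_derivative: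
  "smooth_on S f \<Longrightarrow> smooth_on S (\<lambda>x. frechet_derivative f (at x) v)"
  unfolding smooth_on_def by (metis ck_on.simps(2))

lemma frechet_derivative_bounded_linear:
  assumes "bounded_linear L" "f differentiable (at x)"
  shows "frechet_derivative (\<lambda>y. L (f y)) (at x) v = L (frechet_derivative f (at x) v)"
  using frechet_derivative_at[OF bounded_linear.has_derivative[OF assms(1)
      assms(2)[unfolded frechet_derivative_works]]] by metis

lemma frechet_derivative_cong_open:
  assumes "open S" "x \<in> S" "\<And>y. y \<in> S \<Longrightarrow> f y = g y"
  shows "frechet_derivative f (at x) = frechet_derivative g (at x)"
proof -
  have "(f has_derivative F) (at x) \<longleftrightarrow> (g has_derivative F) (at x)" for F
  proof
    show "(g has_derivative F) (at x)" if "(f has_derivative F) (at x)"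
      by (rule has_derivative_transform_within_open[OF that assms])
    show "(f has_derivative F) (at x)" if "(g has_derivative F) (at x)"
      by (rule has_derivative_transform_within_open[OF that assms(1,2)]) (simp add: assms(3))
  qed
  then show ?thesis by (simp add: frechet_derivative_def)
qed

text \<open>Taking the inner product with a basis vector is bounded linear, hence commutes with both
  derivatives and reduces the claim to real-valued maps.\<close>

lemma smooth_on_symmetric_second_derivative:
  fixes f :: "'v::real_normed_vector \<Rightarrow> 'w::euclidean_space"
  assumes S: "open S" "x \<in> S" and f: "smooth_on S f"
  shows "frechet_derivative (\<lambda>z. frechet_derivative f (at z) u) (at x) v =
    frechet_derivative (\<lambda>z. frechet_derivative f (at z) v) (at x) u"
proof (rule euclidean_eqI)
  fix b :: 'w
  define g where "g y = f y \<bullet> b" for y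
  have L: "bounded_linear (\<lambda>w. w \<bullet> b)"
    by (rule bounded_linear_inner_left)
  have g: "smooth_on S g"
    unfolding g_def using smooth_on_bounded_linear[OF S(1) L f] .
  have D: "frechet_derivative g (at y) w = frechet_derivative f (at y) w \<bullet> b" if "y \<in> S" for y w
    unfolding g_def
    using frechet_derivative_bounded_linear[OF L] smooth_on_imp_differentiable[OF f that] by blast
  have DD: "frechet_derivative (\<lambda>z. frechet_derivative g (at z) w) (at x) w' =
      frechet_derivative (\<lambda>z. frechet_derivative f (at z) w) (at x) w' \<bullet> b" for w w'
  proof -
    have "frechet_derivative (\<lambda>z. frechet_derivative g (at z) w) (at x) =
        frechet_derivative (\<lambda>z. frechet_derivative f (at z) w \<bullet> b) (at x)"
      by (rule frechet_derivative_cong_open[OF S]) (rule D)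
    then show ?thesis
      using frechet_derivative_bounded_linear[OF L
          smooth_on_imp_differentiable[OF smooth_on_frechet_derivative[OF f] S(2)]] by simp
  qed
  have "frechet_derivative (\<lambda>z. frechet_derivative g (at z) u) (at x) v =
      frechet_derivative (\<lambda>z. frechet_derivative g (at z) v) (at x) u"
    by (rule symmetric_second_derivative[OF S])
      (use g in \<open>blast intro: smooth_on_imp_differentiable smooth_on_imp_continuous_on
        smooth_on_frechet_derivative\<close>)+
  then show "frechet_derivative (\<lambda>z. frechet_derivative f (at z) u) (at x) v \<bullet> b =
      frechet_derivative (\<lambda>z. frechet_derivative f (at z) v) (at x) u \<bullet> b"
    by (simp add: DD)
qed

section \<open>Wirtinger derivatives\<close>

text \<open>The parameter \<open>\<sigma>\<close> treats both Wirtinger operators at once: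
  \<open>- \<i>\<close> differentiates along the (1,0)-vector with components \<open>u\<close>, and
  \<open>\<i>\<close> along its conjugate.\<close>

definition wirt :: "complex \<Rightarrow> complex^'n \<Rightarrow> (complex^'n \<Rightarrow> complex) \<Rightarrow> complex^'n \<Rightarrow> complex" where
  "wirt \<sigma> u f x =
     (frechet_derivative f (at x) u + \<sigma> * frechet_derivative f (at x) (\<i> *s u)) / 2"

abbreviation del :: "complex^'n \<Rightarrow> (complex^'n \<Rightarrow> complex) \<Rightarrow> complex^'n \<Rightarrow> complex" where
  "del \<equiv> wirt (- \<i>)"

abbreviation delb :: "complex^'n \<Rightarrow> (complex^'n \<Rightarrow> complex) \<Rightarrow> complex^'n \<Rightarrow> complex" where
  "delb \<equiv> wirt \<i>"

lemma wirt_eq: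
  "(f has_derivative F) (at x) \<Longrightarrow> wirt \<sigma> u f x = (F u + \<sigma> * F (\<i> *s u)) / 2"
  unfolding wirt_def by (metis frechet_derivative_at)

lemma i_vector_scale_axis: "\<i> *s axis i 1 = (axis i \<i> :: complex^'n)"
  by (simp add: vec_eq_iff axis_def)

lemma d_z_eq_del: "d_z i f x = del (axis i 1) f x"
  by (simp add: d_z_def wirt_def i_vector_scale_axis)

lemma d_zbar_eq_delb: "d_zbar i f x = delb (axis i 1) f x"
  by (simp add: d_zbar_def wirt_def i_vector_scale_axis)

lemma frechet_derivative_eq_del_delb: "frechet_derivative f (at x) u = del u f x + delb u f x"
  by (simp add: wirt_def flip: add_divide_distrib)

lemma wirt_cong_open:
  assumes "open S" "x \<in> S" "\<And>y. y \<in> S \<Longrightarrow> f y = g y"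
  shows "wirt \<sigma> u f x = wirt \<sigma> u g x"
  unfolding wirt_def using frechet_derivative_cong_open[OF assms] by simp

lemma wirt_const [simp]: "wirt \<sigma> u (\<lambda>y. a) x = 0"
  by (simp add: wirt_def)

lemma wirt_diff:
  assumes "f differentiable (at x)" "g differentiable (at x)"
  shows "wirt \<sigma> u (\<lambda>y. f y - g y) x = wirt \<sigma> u f x - wirt \<sigma> u g x"
  using wirt_eq[OF has_derivative_diff[OF assms[unfolded frechet_derivative_works]]]
  by (simp add: wirt_def algebra_simps flip: add_divide_distrib diff_divide_distrib)

lemma wirt_mult:
  assumes "f differentiable (at x)" "g differentiable (at x)"
  shows "wirt \<sigma> u (\<lambda>y. f y * g y) x = wirt \<sigma> u f x * g x + f x * wirt \<sigma> u g x"
  using wirt_eq[OF has_derivative_mult[OF assms[unfolded frechet_derivative_works]]]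
  by (simp add: wirt_def algebra_simps flip: add_divide_distrib)

lemma wirt_sum:
  assumes "\<And>i. i \<in> I \<Longrightarrow> f i differentiable (at x)"
  shows "wirt \<sigma> u (\<lambda>y. \<Sum>i\<in>I. f i y) x = (\<Sum>i\<in>I. wirt \<sigma> u (f i) x)"
proof -
  have "((\<lambda>y. \<Sum>i\<in>I. f i y) has_derivative (\<lambda>v. \<Sum>i\<in>I. frechet_derivative (f i) (at x) v)) (at x)"
    using assms by (intro has_derivative_sum) (simp add: frechet_derivative_works)
  from wirt_eq[OF this] show ?thesis
    by (simp add: wirt_def sum.distrib sum_distrib_left flip: sum_divide_distrib)
qed

lemma wirt_cnj:
  assumes "f differentiable (at x)"
  shows "wirt \<sigma> u (\<lambda>y. cnj (f y)) x = cnj (wirt (cnj \<sigma>) u f x)"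
  by (simp add: wirt_def frechet_derivative_bounded_linear[OF bounded_linear_cnj assms])

lemma wirt_add_vector:
  assumes "f differentiable (at x)"
  shows "wirt \<sigma> (u + v) f x = wirt \<sigma> u f x + wirt \<sigma> v f x"
  using linear_frechet_derivative[OF assms]
  by (simp add: wirt_def linear_add vector_add_ldistrib algebra_simps add_divide_distrib)

lemma vector_scale_complex: "a *s u = Re a *\<^sub>R u + Im a *\<^sub>R (\<i> *s u)" for u :: "complex^'n"
  by (simp add: vec_eq_iff complex_eq_iff)

lemma frechet_derivative_vector_scale:
  fixes f :: "complex^'n \<Rightarrow> complex"
  assumes "f differentiable (at x)"
  shows "frechet_derivative f (at x) (a *s u) =
    Re a * frechet_derivative f (at x) u + Im a * frechet_derivative f (at x) (\<i> *s u)"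
  using linear_frechet_derivative[OF assms]
  by (subst vector_scale_complex) (simp add: linear_add linear_cmul scaleR_conv_of_real[where 'a = complex])

lemma wirt_scale_vector:
  assumes "f differentiable (at x)"
  shows "del (a *s u) f x = a * del u f x" "delb (a *s u) f x = cnj a * delb u f x"
proof -
  let ?D = "frechet_derivative f (at x)"
  have 1: "?D (a *s u) = Re a * ?D u + Im a * ?D (\<i> *s u)"
    by (rule frechet_derivative_vector_scale[OF assms])
  have 2: "?D (\<i> *s (a *s u)) = Re a * ?D (\<i> *s u) - Im a * ?D u"
    using frechet_derivative_vector_scale[OF assms, of "\<i> * a" u]
    by (simp add: vector_smult_assoc)
  have 3: "(r * p + s * q + - \<i> * (r * q - s * p)) / 2 = (r + \<i> * s) * ((p + - \<i> * q) / 2)"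
    "(r * p + s * q + \<i> * (r * q - s * p)) / 2 = (r - \<i> * s) * ((p + \<i> * q) / 2)" for p q r s
    by (simp_all add: field_simps)
  have 4: "Re a + \<i> * Im a = a" "Re a - \<i> * Im a = cnj a"
    by (simp_all add: complex_eq_iff)
  show "del (a *s u) f x = a * del u f x" "delb (a *s u) f x = cnj a * delb u f x"
    unfolding wirt_def 1 2 3 4 by (rule refl)+
qed

lemma wirt_zero_vector [simp]: "f differentiable (at x) \<Longrightarrow> wirt \<sigma> 0 f x = 0"
  using wirt_add_vector[of f x \<sigma> 0 0] by simp

lemma wirt_sum_vector:
  assumes "f differentiable (at x)"
  shows "wirt \<sigma> (\<Sum>i\<in>I. u i) f x = (\<Sum>i\<in>I. wirt \<sigma> (u i) f x)"
  by (induction I rule: infinite_finite_induct) (simp_all add: assms wirt_add_vector)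

lemma smooth_on_wirt:
  assumes "open S" "smooth_on S f"
  shows "smooth_on S (wirt \<sigma> u f)"
proof -
  have D: "smooth_on S (\<lambda>x. frechet_derivative f (at x) w)" for w
    using assms(2) by (rule smooth_on_frechet_derivative)
  have "smooth_on S (\<lambda>x. (frechet_derivative f (at x) u +
      \<sigma> * frechet_derivative f (at x) (\<i> *s u)) / 2)"
    by (rule smooth_on_bounded_linear[OF assms(1) bounded_linear_divide
        smooth_on_add[OF assms(1) D smooth_on_bounded_linear[OF assms(1) bounded_linear_mult_right D]]])
  then show ?thesis by (simp add: wirt_def[abs_def])
qed

lemma frechet_derivative_wirt:
  assumes S: "open S" "x \<in> S" and f: "smooth_on S f"
  shows "frechet_derivative (wirt \<sigma> u f) (at x) v = wirt \<sigma> u (\<lambda>y. frechet_derivative f (at y) v) x"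
proof -
  let ?D = "\<lambda>w y. frechet_derivative f (at y) w"
  have D: "(?D w has_derivative (frechet_derivative (?D w) (at x))) (at x)" for w
    using smooth_on_imp_differentiable[OF smooth_on_frechet_derivative[OF f] S(2)]
    by (simp add: frechet_derivative_works)
  have "((\<lambda>y. (?D u y + \<sigma> * ?D (\<i> *s u) y) / 2) has_derivative
      (\<lambda>w. (frechet_derivative (?D u) (at x) w + \<sigma> * frechet_derivative (?D (\<i> *s u)) (at x) w) / 2)) (at x)"
    by (intro bounded_linear.has_derivative[OF bounded_linear_divide] has_derivative_add
        has_derivative_mult_right D)
  from frechet_derivative_at[OF this, symmetric] show ?thesis
    using smooth_on_symmetric_second_derivative[OF S f]
    by (simp add: wirt_def[abs_def])
qed

text \<open>The directions are constant, so the claim reduces to symmetry of second derivatives for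
  the four pairs formed from \<open>u\<close>, \<open>\<i> *s u\<close> and \<open>v\<close>,
  \<open>\<i> *s v\<close>. Curvature identities arise below by exchanging \<open>del\<close> and
  \<open>delb\<close> in this way.\<close>

lemma wirt_commute:
  assumes S: "open S" "x \<in> S" and f: "smooth_on S f"
  shows "wirt \<sigma> u (wirt \<tau> v f) x = wirt \<tau> v (wirt \<sigma> u f) x"
proof -
  let ?D = "\<lambda>a b. frechet_derivative (\<lambda>y. frechet_derivative f (at y) a) (at x) b"
  have eq: "wirt \<sigma> u (wirt \<tau> v f) x =
      (?D u v + \<tau> * ?D u (\<i> *s v) + \<sigma> * (?D (\<i> *s u) v + \<tau> * ?D (\<i> *s u) (\<i> *s v))) / 4"
    for \<sigma> \<tau> u v
    unfolding wirt_def[of \<sigma> u "wirt \<tau> v f"] frechet_derivative_wirt[OF assms]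
    by (simp add: wirt_def field_simps)
  show ?thesis
    unfolding eq
    using smooth_on_symmetric_second_derivative[OF assms, of u v]
      smooth_on_symmetric_second_derivative[OF assms, of "\<i> *s u" v]
      smooth_on_symmetric_second_derivative[OF assms, of u "\<i> *s v"]
      smooth_on_symmetric_second_derivative[OF assms, of "\<i> *s u" "\<i> *s v"]
    by (simp add: algebra_simps)
qed

section \<open>Hermitian forms and the Chern connection\<close>

lemma herm_form_add_left: "herm_form M (u + u') v = herm_form M u v + herm_form M u' v"
  by (simp add: herm_form_def algebra_simps sum.distrib)

lemma herm_form_add_right: "herm_form M u (v + v') = herm_form M u v + herm_form M u v'"
  by (simp add: herm_form_def algebra_simps sum.distrib)

lemma herm_form_diff_left: "herm_form M (u - u') v = herm_form M u v - herm_form M u' v"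
  by (simp add: herm_form_def algebra_simps sum_subtractf)

lemma herm_form_scale_left: "herm_form M (a *s u) v = a * herm_form M u v"
  by (simp add: herm_form_def sum_distrib_left algebra_simps)

lemma herm_form_scale_right: "herm_form M u (a *s v) = cnj a * herm_form M u v"
  by (simp add: herm_form_def sum_distrib_left algebra_simps)

lemma herm_form_zero_left [simp]: "herm_form M 0 v = 0"
  by (simp add: herm_form_def)

lemma herm_form_zero_right [simp]: "herm_form M u 0 = 0"
  by (simp add: herm_form_def)

lemma herm_form_axis_right: "herm_form M u (axis l 1) = (\<Sum>i\<in>UNIV. M $ i $ l * u $ i)"
proof -
  have "M $ i $ j * u $ i * cnj (axis l 1 $ j) = (if j = l then M $ i $ j * u $ i else 0)" for i j
    by (simp add: axis_def)
  then show ?thesis by (simp add: herm_form_def)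
qed

lemma herm_form_axis: "herm_form M (axis k 1) (axis l 1) = M $ k $ l"
proof -
  have "M $ i $ l * axis k 1 $ i = (if i = k then M $ i $ l else 0)" for i
    by (simp add: axis_def)
  then show ?thesis by (simp add: herm_form_axis_right)
qed

lemma herm_form_expand_left: "herm_form M u v = (\<Sum>k\<in>UNIV. u $ k * herm_form M (axis k 1) v)"
proof -
  have "(\<Sum>i\<in>UNIV. \<Sum>j\<in>UNIV. M $ i $ j * axis k 1 $ i * cnj (v $ j)) =
      (\<Sum>i\<in>UNIV. if i = k then \<Sum>j\<in>UNIV. M $ k $ j * cnj (v $ j) else 0)" for k
    by (rule sum.cong) (auto simp: axis_def)
  then show ?thesis by (simp add: herm_form_def sum_distrib_left mult_ac)
qed

lemma herm_form_expand_right: "herm_form M u v = (\<Sum>l\<in>UNIV. cnj (v $ l) * herm_form M u (axis l 1))"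
proof -
  have "herm_form M u v = (\<Sum>l\<in>UNIV. cnj (v $ l) * (\<Sum>i\<in>UNIV. M $ i $ l * u $ i))"
    unfolding herm_form_def by (subst sum.swap) (simp add: sum_distrib_left mult_ac)
  then show ?thesis by (simp add: herm_form_axis_right)
qed

lemma bounded_linear_herm_form: "bounded_linear (\<lambda>M :: complex^'n^'n. herm_form M u v)"
proof (rule linear_conv_bounded_linear[THEN iffD1], rule linearI)
  show "herm_form (M + N) u v = herm_form M u v + herm_form N u v" for M N :: "complex^'n^'n"
    by (simp add: herm_form_def algebra_simps sum.distrib)
  show "herm_form (r *\<^sub>R M) u v = r *\<^sub>R herm_form M u v" for r and M :: "complex^'n^'n"
    unfolding herm_form_def scaleR_sum_right by simp
qed

lemma herm_form_cnj:
  assumes "pos_def_hermitian M"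
  shows "cnj (herm_form M u v) = herm_form M v u"
proof -
  have "cnj (M $ i $ j) = M $ j $ i" for i j
    using assms unfolding pos_def_hermitian_def by metis
  then have "cnj (herm_form M u v) = (\<Sum>i\<in>UNIV. \<Sum>j\<in>UNIV. M $ j $ i * v $ j * cnj (u $ i))"
    by (simp add: herm_form_def mult_ac)
  then show ?thesis
    by (subst (asm) sum.swap) (simp add: herm_form_def)
qed

lemma herm_form_eq_0_iff:
  assumes "pos_def_hermitian M"
  shows "herm_form M v v = 0 \<longleftrightarrow> v = 0"
  using assms by (auto simp: pos_def_hermitian_def dest: spec[of _ v])

lemma herm_form_cancel_right:
  assumes "pos_def_hermitian M" "\<And>w. herm_form M u w = herm_form M v w"
  shows "u = v"
  using assms(2)[of "u - v"] herm_form_eq_0_iff[OF assms(1), of "u - v"]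
  by (simp add: herm_form_diff_left)

lemma pos_def_hermitian_invertible:
  assumes "pos_def_hermitian M"
  shows "invertible M"
proof -
  have "z = 0" if "M *v z = 0" for z
  proof -
    \<comment> \<open>\<open>herm_form\<close> conjugates its second argument, so the conjugate of
      \<open>z\<close> is the vector for which \<open>M *v z\<close> appears in
      \<open>herm_form M v v\<close>.\<close>
    define v where "v = (\<chi> i. cnj (z $ i))"
    have "herm_form M v v = (\<Sum>i\<in>UNIV. v $ i * (M *v z) $ i)"
      by (simp add: herm_form_def v_def matrix_vector_mult_def sum_distrib_left mult_ac)
    then have "v = 0"
      using that herm_form_eq_0_iff[OF assms] by simp
    then show ?thesis by (simp add: v_def vec_eq_iff)
  qed
  then show ?thesis
    by (simp add: invertible_left_inverse matrix_left_invertible_ker)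
qed

lemma sum_reverse3:
  "(\<Sum>i\<in>I. \<Sum>j\<in>J. \<Sum>k\<in>K. f i j k) = (\<Sum>k\<in>K. \<Sum>j\<in>J. \<Sum>i\<in>I. f i j k)"
proof -
  have "(\<Sum>i\<in>I. \<Sum>j\<in>J. \<Sum>k\<in>K. f i j k) = (\<Sum>i\<in>I. \<Sum>k\<in>K. \<Sum>j\<in>J. f i j k)"
    by (rule sum.cong[OF refl], rule sum.swap)
  also have "\<dots> = (\<Sum>k\<in>K. \<Sum>i\<in>I. \<Sum>j\<in>J. f i j k)"
    by (rule sum.swap)
  also have "\<dots> = (\<Sum>k\<in>K. \<Sum>j\<in>J. \<Sum>i\<in>I. f i j k)"
    by (rule sum.cong[OF refl], rule sum.swap)
  finally show ?thesis .
qed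

section \<open>Differentiability of the inverse matrix\<close>

lemma matrix_inv_mult:
  assumes "invertible A"
  shows "A ** matrix_inv A = mat 1" "matrix_inv A ** A = mat 1"
  using someI_ex[OF assms[unfolded invertible_def]] by (simp_all add: matrix_inv_def)

text \<open>Column \<open>k\<close> of the inverse solves a linear system with right side
  \<open>axis k 1\<close>, so Cramer's rule applies. As a quotient of determinants the entry is
  visibly differentiable in the entries of \<open>A\<close>.\<close>

lemma matrix_inv_entry:
  fixes A :: "'a::field^'n^'n"
  assumes "invertible A"
  shows "matrix_inv A $ l $ k = det (\<chi> i j. if j = l then axis k 1 $ i else A $ i $ j) / det A"
proof -
  have "A *v column k (matrix_inv A) = axis k 1"
    using matrix_inv_mult(1)[OF assms]
    by (auto simp: vec_eq_iff matrix_vector_mult_def matrix_matrix_mult_def column_def mat_def axis_def)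
  then have "column k (matrix_inv A) $ l = (\<chi> l. det (\<chi> i j. if j = l then axis k 1 $ i else A $ i $ j) / det A) $ l"
    using cramer[of A "column k (matrix_inv A)" "axis k 1"] assms
    by (simp add: invertible_det_nz)
  then show ?thesis by (simp add: column_def)
qed

lemma differentiable_prod:
  fixes f :: "'i \<Rightarrow> 'v::real_normed_vector \<Rightarrow> 'w::real_normed_field"
  assumes "\<And>i. i \<in> I \<Longrightarrow> f i differentiable (at x)"
  shows "(\<lambda>y. \<Prod>i\<in>I. f i y) differentiable (at x)"
  using assms by (induction I rule: infinite_finite_induct) auto

lemma differentiable_det:
  fixes A :: "'v::real_normed_vector \<Rightarrow> 'w::real_normed_field^'n^'n"
  assumes "\<And>i j. (\<lambda>y. A y $ i $ j) differentiable (at x)"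
  shows "(\<lambda>y. det (A y)) differentiable (at x)"
  unfolding det_def
  by (intro differentiable_sum ballI differentiable_mult differentiable_const differentiable_prod assms) simp

lemma differentiable_cong_open:
  assumes "open S" "x \<in> S" "\<And>y. y \<in> S \<Longrightarrow> f y = g y" "f differentiable (at x)"
  shows "g differentiable (at x)"
proof -
  from assms(4) obtain D where "(f has_derivative D) (at x)"
    by (auto simp: differentiable_def)
  then have "(g has_derivative D) (at x)"
    by (rule has_derivative_transform_within_open[OF _ assms(1-3)])
  then show ?thesis by (auto simp: differentiable_def)
qed

lemma differentiable_matrix_inv_entry:
  fixes A :: "'v::real_normed_vector \<Rightarrow> 'w::real_normed_field^'n^'n"
  assumes S: "open S" "x \<in> S" and inv: "\<And>y. y \<in> S \<Longrightarrow> invertible (A y)"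
    and A: "\<And>i j. (\<lambda>y. A y $ i $ j) differentiable (at x)"
  shows "(\<lambda>y. matrix_inv (A y) $ l $ k) differentiable (at x)"
proof (rule differentiable_cong_open[OF S])
  let ?N = "\<lambda>y. det (\<chi> i j. if j = l then axis k 1 $ i else A y $ i $ j)"
  show "?N y / det (A y) = matrix_inv (A y) $ l $ k" if "y \<in> S" for y
    using matrix_inv_entry[OF inv[OF that]] by simp
  have "(\<lambda>y. if j = l then axis k 1 $ i else A y $ i $ j) differentiable (at x)" for i j
    using A by (cases "j = l") simp_all
  then have "?N differentiable (at x)"
    by (intro differentiable_det) simp
  moreover have "det (A x) \<noteq> 0"
    using inv[OF S(2)] by (simp add: invertible_det_nz)
  ultimately show "(\<lambda>y. ?N y / det (A y)) differentiable (at x)"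
    by (intro differentiable_divide differentiable_det[of A] A)
qed

lemma complex_vec_eq_sum_axis: "u = (\<Sum>i\<in>UNIV. u $ i *s axis i 1)" for u :: "complex^'n"
  by (simp add: vec_eq_iff axis_def if_distrib cong: if_cong)

lemma del_expand:
  assumes "f differentiable (at x)"
  shows "del u f x = (\<Sum>i\<in>UNIV. u $ i * d_z i f x)"
  by (subst complex_vec_eq_sum_axis)
    (simp add: wirt_sum_vector[OF assms] wirt_scale_vector[OF assms] d_z_eq_del)

lemma delb_expand:
  assumes "f differentiable (at x)"
  shows "delb u f x = (\<Sum>i\<in>UNIV. cnj (u $ i) * d_zbar i f x)"
  by (subst complex_vec_eq_sum_axis)
    (simp add: wirt_sum_vector[OF assms] wirt_scale_vector[OF assms] d_zbar_eq_delb)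

lemma wirt_mult_const:
  assumes "f differentiable (at x)"
  shows "wirt \<sigma> u (\<lambda>y. a * f y) x = a * wirt \<sigma> u f x"
  using wirt_mult[of "\<lambda>y. a" x f \<sigma> u] assms by simp

lemma exists_other_index:
  assumes "CARD('n::finite) \<ge> 2"
  shows "\<exists>j. j \<noteq> (i :: 'n)"
proof (rule ccontr)
  assume "\<nexists>j. j \<noteq> i"
  then have "(UNIV :: 'n set) = {i}" by auto
  then have "CARD('n) = card {i}" by (rule arg_cong)
  then show False using assms by simp
qed

lemma differentiable_cnj: "f differentiable (at x) \<Longrightarrow> (\<lambda>y. cnj (f y)) differentiable (at x)"
  unfolding frechet_derivative_works[of f]
  by (rule differentiableI[OF bounded_linear.has_derivative[OF bounded_linear_cnj]])

section \<open>Chern connection and curvature in one chart\<close>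

locale hermitian_chart =
  fixes U :: "(complex^'n) set" and h :: "complex^'n \<Rightarrow> complex^'n^'n"
  assumes open_U: "open U"
    and smooth_h: "smooth_on U h"
    and pos_def: "\<And>x. x \<in> U \<Longrightarrow> pos_def_hermitian (h x)"
begin

definition H :: "complex^'n \<Rightarrow> complex^'n \<Rightarrow> complex^'n \<Rightarrow> complex" where
  "H u v y = herm_form (h y) u v"

text \<open>For constant \<open>v\<close> this is the Chern covariant derivative of \<open>v\<close>
  in the (1,0)-direction \<open>u\<close>.\<close>

definition conn :: "complex^'n \<Rightarrow> complex^'n \<Rightarrow> complex^'n \<Rightarrow> complex^'n" where
  "conn u v y = (\<chi> p. \<Sum>i\<in>UNIV. \<Sum>k\<in>UNIV. u $ i * v $ k * chern_gamma h i k p y)"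

text \<open>Up to sign this is the Chern curvature with its last index raised: R(u, w, v, z),
  conjugate linear in \<open>w\<close> and \<open>z\<close>, equals
  \<open>- H (dbar_conn w u v y) z y\<close>.\<close>

definition dbar_conn :: "complex^'n \<Rightarrow> complex^'n \<Rightarrow> complex^'n \<Rightarrow> complex^'n \<Rightarrow> complex^'n" where
  "dbar_conn w u v y = (\<chi> p. delb w (\<lambda>z. conn u v z $ p) y)"

lemma smooth_H: "smooth_on U (H u v)"
  unfolding H_def[abs_def]
  by (rule smooth_on_bounded_linear[OF open_U bounded_linear_herm_form smooth_h])

lemma smooth_wirt_H: "smooth_on U (wirt \<sigma> w (H u v))"
  by (rule smooth_on_wirt[OF open_U smooth_H])

lemma diff_H: "x \<in> U \<Longrightarrow> H u v differentiable (at x)"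
  by (rule smooth_on_imp_differentiable[OF smooth_H])

lemma diff_wirt_H: "x \<in> U \<Longrightarrow> wirt \<sigma> w (H u v) differentiable (at x)"
  by (rule smooth_on_imp_differentiable[OF smooth_wirt_H])

lemma H_cnj: "y \<in> U \<Longrightarrow> cnj (H u v y) = H v u y"
  by (simp add: H_def herm_form_cnj[OF pos_def])

lemma wirt_H_cnj:
  assumes "x \<in> U"
  shows "wirt \<sigma> w (H u v) x = cnj (wirt (cnj \<sigma>) w (H v u) x)"
proof -
  have "wirt \<sigma> w (H u v) x = wirt \<sigma> w (\<lambda>y. cnj (H v u y)) x"
    by (rule wirt_cong_open[OF open_U assms]) (simp add: H_cnj)
  then show ?thesis
    by (simp add: wirt_cnj[OF diff_H[OF assms]])
qed

lemma wirt_H_expand_left: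
  assumes "x \<in> U"
  shows "wirt \<sigma> w (H u v) x = (\<Sum>k\<in>UNIV. u $ k * wirt \<sigma> w (H (axis k 1) v) x)"
proof -
  have "H u v = (\<lambda>y. \<Sum>k\<in>UNIV. u $ k * H (axis k 1) v y)"
    unfolding H_def by (rule ext, rule herm_form_expand_left)
  then show ?thesis
    by (simp add: wirt_sum wirt_mult_const diff_H[OF assms])
qed

lemma wirt_H_expand_right:
  assumes "x \<in> U"
  shows "wirt \<sigma> w (H u v) x = (\<Sum>l\<in>UNIV. cnj (v $ l) * wirt \<sigma> w (H u (axis l 1)) x)"
proof -
  have "H u v = (\<lambda>y. \<Sum>l\<in>UNIV. cnj (v $ l) * H u (axis l 1) y)"
    unfolding H_def by (rule ext, rule herm_form_expand_right)
  then show ?thesis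
    by (simp add: wirt_sum wirt_mult_const diff_H[OF assms])
qed

lemma chern_gamma_lower:
  assumes "y \<in> U"
  shows "(\<Sum>p\<in>UNIV. h y $ p $ l * chern_gamma h i k p y) = del (axis i 1) (H (axis k 1) (axis l 1)) y"
proof -
  have 1: "(\<Sum>p\<in>UNIV. matrix_inv (h y) $ m $ p * h y $ p $ l) = (if m = l then 1 else 0)" for m
    using matrix_inv_mult(2)[OF pos_def_hermitian_invertible[OF pos_def[OF assms]]]
    by (auto simp: vec_eq_iff matrix_matrix_mult_def mat_def)
  have "(\<Sum>p\<in>UNIV. h y $ p $ l * chern_gamma h i k p y) =
      (\<Sum>m\<in>UNIV. (\<Sum>p\<in>UNIV. matrix_inv (h y) $ m $ p * h y $ p $ l) * d_z i (\<lambda>y. h y $ k $ m) y)"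
    unfolding chern_gamma_def sum_distrib_left sum_distrib_right
    by (subst sum.swap) (simp add: mult_ac)
  also have "\<dots> = d_z i (\<lambda>y. h y $ k $ l) y"
    unfolding 1 by (simp add: if_distrib[of "\<lambda>a. a * _"] cong: if_cong)
  finally show ?thesis
    by (simp add: d_z_eq_del H_def[abs_def] herm_form_axis)
qed

text \<open>This is metric compatibility of the Chern connection. A constant field \<open>w\<close>
  is holomorphic, so its conjugate contributes nothing in a (1,0)-direction.\<close>

lemma H_conn:
  assumes "y \<in> U"
  shows "H (conn u v y) w y = del u (H v w) y"
proof -
  have "H (conn u v y) (axis l 1) y =
      (\<Sum>i\<in>UNIV. \<Sum>k\<in>UNIV. u $ i * (v $ k * del (axis i 1) (H (axis k 1) (axis l 1)) y))" for l
  proof -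
    have "H (conn u v y) (axis l 1) y =
        (\<Sum>p\<in>UNIV. \<Sum>i\<in>UNIV. \<Sum>k\<in>UNIV. u $ i * (v $ k * (h y $ p $ l * chern_gamma h i k p y)))"
      unfolding H_def herm_form_axis_right conn_def by (simp add: sum_distrib_left mult_ac)
    also have "\<dots> = (\<Sum>i\<in>UNIV. \<Sum>k\<in>UNIV. \<Sum>p\<in>UNIV. u $ i * (v $ k * (h y $ p $ l * chern_gamma h i k p y)))"
      by (subst sum.swap, rule sum.cong[OF refl], rule sum.swap)
    finally show ?thesis
      by (simp add: chern_gamma_lower[OF assms] flip: sum_distrib_left)
  qed
  moreover have "del u (H v (axis l 1)) y =
      (\<Sum>i\<in>UNIV. \<Sum>k\<in>UNIV. u $ i * (v $ k * del (axis i 1) (H (axis k 1) (axis l 1)) y))" for l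
  proof -
    have "del u (H v (axis l 1)) y = (\<Sum>i\<in>UNIV. u $ i * del (axis i 1) (H v (axis l 1)) y)"
      by (rule del_expand[OF diff_H[OF assms], unfolded d_z_eq_del])
    also have "\<dots> = (\<Sum>i\<in>UNIV. u $ i *
        (\<Sum>k\<in>UNIV. v $ k * del (axis i 1) (H (axis k 1) (axis l 1)) y))"
      by (subst wirt_H_expand_left[OF assms]) (rule refl)
    finally show ?thesis by (simp only: sum_distrib_left)
  qed
  ultimately have "H (conn u v y) (axis l 1) y = del u (H v (axis l 1)) y" for l
    by simp
  then show ?thesis
    unfolding wirt_H_expand_right[OF assms, of _ _ _ w]
    unfolding H_def herm_form_expand_right[of _ _ w] by simp
qed

lemma diff_chern_gamma:
  assumes "x \<in> U"
  shows "chern_gamma h i k p differentiable (at x)"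
proof -
  have "(\<lambda>y. matrix_inv (h y) $ l $ p) differentiable (at x)" for l
  proof (rule differentiable_matrix_inv_entry[OF open_U assms])
    show "invertible (h y)" if "y \<in> U" for y
      by (rule pos_def_hermitian_invertible[OF pos_def[OF that]])
    show "(\<lambda>y. h y $ i $ j) differentiable (at x)" for i j
      using diff_H[OF assms, of "axis i 1" "axis j 1"] by (simp add: H_def[abs_def] herm_form_axis)
  qed
  moreover have "(\<lambda>y. d_z i (\<lambda>z. h z $ k $ l) y) differentiable (at x)" for l
    using diff_wirt_H[OF assms, of "-\<i>" "axis i 1" "axis k 1" "axis l 1"]
    by (simp add: d_z_eq_del[abs_def] H_def[abs_def] herm_form_axis)
  ultimately show ?thesis
    unfolding chern_gamma_def[abs_def] by (intro differentiable_sum ballI differentiable_mult) simp_all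
qed

lemma diff_conn:
  assumes "x \<in> U"
  shows "(\<lambda>y. conn u v y $ p) differentiable (at x)"
  unfolding conn_def vec_lambda_beta
  by (intro differentiable_sum ballI differentiable_mult differentiable_const diff_chern_gamma[OF assms])
    simp_all

lemma dbar_conn_expand:
  assumes "x \<in> U"
  shows "dbar_conn w u v x $ p =
    (\<Sum>j\<in>UNIV. \<Sum>i\<in>UNIV. \<Sum>k\<in>UNIV. cnj (w $ j) * u $ i * v $ k * d_zbar j (chern_gamma h i k p) x)"
proof -
  have *: "delb w (chern_gamma h i k p) x = (\<Sum>j\<in>UNIV. cnj (w $ j) * d_zbar j (chern_gamma h i k p) x)" for i k
    by (rule delb_expand[OF diff_chern_gamma[OF assms]])
  have "dbar_conn w u v x $ p = (\<Sum>i\<in>UNIV. \<Sum>k\<in>UNIV. u $ i * v $ k * delb w (chern_gamma h i k p) x)"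
    unfolding dbar_conn_def conn_def
    by (simp add: wirt_sum wirt_mult_const diff_chern_gamma[OF assms])
  also have "\<dots> = (\<Sum>i\<in>UNIV. \<Sum>k\<in>UNIV. \<Sum>j\<in>UNIV.
      cnj (w $ j) * u $ i * v $ k * d_zbar j (chern_gamma h i k p) x)"
    unfolding * sum_distrib_left by (simp add: mult_ac)
  also have "\<dots> = (\<Sum>i\<in>UNIV. \<Sum>j\<in>UNIV. \<Sum>k\<in>UNIV.
      cnj (w $ j) * u $ i * v $ k * d_zbar j (chern_gamma h i k p) x)"
    by (rule sum.cong[OF refl], rule sum.swap)
  also have "\<dots> = (\<Sum>j\<in>UNIV. \<Sum>i\<in>UNIV. \<Sum>k\<in>UNIV.
      cnj (w $ j) * u $ i * v $ k * d_zbar j (chern_gamma h i k p) x)"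
    by (rule sum.swap)
  finally show ?thesis .
qed

lemma hol_sect_curv_eq:
  assumes "x \<in> U"
  shows "hol_sect_curv h x X = - H (dbar_conn X X X x) X x / (H X X x)\<^sup>2"
proof -
  have "(\<Sum>i\<in>UNIV. \<Sum>j\<in>UNIV. \<Sum>k\<in>UNIV. \<Sum>l\<in>UNIV.
      chern_curv h i j k l x * X $ i * cnj (X $ j) * X $ k * cnj (X $ l)) = - H (dbar_conn X X X x) X x"
  proof -
    let ?F = "\<lambda>i j k l p. h x $ p $ l * (cnj (X $ j) * X $ i * X $ k * d_zbar j (chern_gamma h i k p) x) *
      cnj (X $ l)"
    have "chern_curv h i j k l x * X $ i * cnj (X $ j) * X $ k * cnj (X $ l) =
        - (\<Sum>p\<in>UNIV. ?F i j k l p)" for i j k l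
      by (simp add: chern_curv_def sum_distrib_left sum_distrib_right mult_ac)
    then have "(\<Sum>i\<in>UNIV. \<Sum>j\<in>UNIV. \<Sum>k\<in>UNIV. \<Sum>l\<in>UNIV.
        chern_curv h i j k l x * X $ i * cnj (X $ j) * X $ k * cnj (X $ l)) =
        - (\<Sum>i\<in>UNIV. \<Sum>j\<in>UNIV. \<Sum>k\<in>UNIV. \<Sum>l\<in>UNIV. \<Sum>p\<in>UNIV. ?F i j k l p)"
      by (simp add: sum_negf)
    \<comment> \<open>The exchanges lead to the order p, l, j, i, k, which is the one produced by
      expanding \<open>H\<close> and then \<open>dbar_conn_expand\<close>.\<close>
    also have "(\<Sum>i\<in>UNIV. \<Sum>j\<in>UNIV. \<Sum>k\<in>UNIV. \<Sum>l\<in>UNIV. \<Sum>p\<in>UNIV. ?F i j k l p) =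
        (\<Sum>i\<in>UNIV. \<Sum>j\<in>UNIV. \<Sum>p\<in>UNIV. \<Sum>l\<in>UNIV. \<Sum>k\<in>UNIV. ?F i j k l p)"
      by (rule sum.cong[OF refl], rule sum.cong[OF refl], rule sum_reverse3)
    also have "\<dots> = (\<Sum>p\<in>UNIV. \<Sum>j\<in>UNIV. \<Sum>i\<in>UNIV. \<Sum>l\<in>UNIV. \<Sum>k\<in>UNIV. ?F i j k l p)"
      by (rule sum_reverse3)
    also have "\<dots> = (\<Sum>p\<in>UNIV. \<Sum>l\<in>UNIV. \<Sum>i\<in>UNIV. \<Sum>j\<in>UNIV. \<Sum>k\<in>UNIV. ?F i j k l p)"
      by (rule sum.cong[OF refl], rule sum_reverse3)
    also have "\<dots> = (\<Sum>p\<in>UNIV. \<Sum>l\<in>UNIV. \<Sum>j\<in>UNIV. \<Sum>i\<in>UNIV. \<Sum>k\<in>UNIV. ?F i j k l p)"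
      by (rule sum.cong[OF refl], rule sum.cong[OF refl], rule sum.swap)
    also have "\<dots> = H (dbar_conn X X X x) X x"
      by (simp add: H_def herm_form_def dbar_conn_expand[OF assms] sum_distrib_left sum_distrib_right)
    finally show ?thesis .
  qed
  then show ?thesis by (simp add: hol_sect_curv_def H_def)
qed

text \<open>Differentiating \<open>H_conn\<close> once more yields two terms: one from the
  connection vector, which is the curvature, and one from the metric.\<close>

lemma delb_del_H:
  assumes "x \<in> U"
  shows "H (dbar_conn z u v x) w x = delb z (del u (H v w)) x - H (conn u v x) (conn z w x) x"
proof -
  have "delb z (del u (H v w)) x = delb z (\<lambda>y. \<Sum>p\<in>UNIV. conn u v y $ p * H (axis p 1) w y) x"
    by (rule wirt_cong_open[OF open_U assms])
      (simp add: H_conn[symmetric], simp add: H_def herm_form_expand_left[of _ "conn _ _ _"])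
  also have "\<dots> = (\<Sum>p\<in>UNIV. dbar_conn z u v x $ p * H (axis p 1) w x + conn u v x $ p * delb z (H (axis p 1) w) x)"
    by (simp add: wirt_sum wirt_mult diff_conn[OF assms] diff_H[OF assms] dbar_conn_def)
  also have "\<dots> = H (dbar_conn z u v x) w x + (\<Sum>p\<in>UNIV. conn u v x $ p * H (axis p 1) (conn z w x) x)"
  proof -
    \<comment> \<open>Conjugation turns \<open>delb\<close> on the second argument into
      \<open>del\<close> on the first, where metric compatibility applies.\<close>
    have "delb z (H (axis p 1) w) x = H (axis p 1) (conn z w x) x" for p
      using wirt_H_cnj[OF assms, of \<i> z "axis p 1" w] H_conn[OF assms, of z w "axis p 1"]
        H_cnj[OF assms, of "conn z w x" "axis p 1"] by simp
    then show ?thesis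
      by (simp add: H_def herm_form_expand_left[of _ "dbar_conn _ _ _ _"] sum.distrib)
  qed
  also have "\<dots> = H (dbar_conn z u v x) w x + H (conn u v x) (conn z w x) x"
    by (simp add: H_def herm_form_expand_left[of _ "conn u v x"])
  finally show ?thesis by simp
qed

text \<open>Conjugation exchanges \<open>del\<close> and \<open>delb\<close> as well as the
  arguments of \<open>H\<close>; the two operators commute, and the remaining term of
  \<open>delb_del_H\<close> has the same symmetry.\<close>

lemma dbar_conn_hermitian:
  assumes "x \<in> U"
  shows "cnj (H (dbar_conn w u v x) z x) = H (dbar_conn u w z x) v x"
proof -
  have "cnj (delb w (del u (H v z)) x) = del w (\<lambda>y. cnj (del u (H v z) y)) x"
    by (simp add: wirt_cnj[OF diff_wirt_H[OF assms]])
  also have "\<dots> = del w (delb u (H z v)) x"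
    by (rule wirt_cong_open[OF open_U assms]) (simp add: wirt_H_cnj[of _ _ _ z v])
  also have "\<dots> = delb u (del w (H z v)) x"
    by (rule wirt_commute[OF open_U assms smooth_H])
  finally show ?thesis
    by (simp add: delb_del_H[OF assms] H_cnj[OF assms])
qed

end

section \<open>Vaisman metrics in a chart\<close>

locale vaisman_chart = hermitian_chart U h
  for U :: "(complex^'n) set" and h +
  fixes \<theta> :: "complex^'n \<Rightarrow> complex^'n \<Rightarrow> real"
    and \<Gamma> :: "complex^'n \<Rightarrow> complex^'n \<Rightarrow> complex^'n \<Rightarrow> complex^'n"
  assumes linear_theta: "\<And>x. x \<in> U \<Longrightarrow> linear (\<theta> x)"
    and smooth_theta: "\<And>v. smooth_on U (\<lambda>x. \<theta> x v)"
    and lck: "\<And>x u v w. x \<in> U \<Longrightarrow> ext_deriv2 (\<lambda>y. fundamental_form (h y)) x u v w =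
      wedge12 (\<theta> x) (fundamental_form (h x)) u v w"
    and levi_civita: "levi_civita_on U (\<lambda>y. riemannian_metric (h y)) \<Gamma>"
    and parallel: "parallel_on U \<Gamma> \<theta>"
begin

definition eta :: "complex^'n \<Rightarrow> complex^'n \<Rightarrow> complex" where
  "eta v y = (of_real (\<theta> y v) + - \<i> * of_real (\<theta> y (\<i> *s v))) / 2"

text \<open>The conjugate compensates for the antilinear second argument of \<open>H\<close>, so
  that \<open>H v (lee_vec y) y = eta v y\<close>. In particular \<open>eta (lee_vec y) y\<close> is
  the squared length s.\<close>

definition lee_vec :: "complex^'n \<Rightarrow> complex^'n" where
  "lee_vec y = (\<chi> j. cnj ((matrix_inv (h y) *v (\<chi> p. eta (axis p 1) y)) $ j))"

definition beta :: "complex^'n \<Rightarrow> complex^'n \<Rightarrow> complex^'n \<Rightarrow> complex" where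
  "beta u v y = eta u y * cnj (eta v y) - eta (lee_vec y) y * H u v y"

lemma theta_eq: "\<theta> y v = 2 * Re (eta v y)"
  by (simp add: eta_def)

lemma eta_add: "y \<in> U \<Longrightarrow> eta (u + v) y = eta u y + eta v y"
  by (simp add: eta_def vector_add_ldistrib linear_add[OF linear_theta] field_simps)

lemma eta_scale:
  assumes "y \<in> U"
  shows "eta (a *s v) y = a * eta v y"
proof -
  have *: "\<theta> y (a *s v) = Re a * \<theta> y v + Im a * \<theta> y (\<i> *s v)" for a v
    by (subst vector_scale_complex) (simp add: linear_add[OF linear_theta] linear_cmul[OF linear_theta] assms)
  have "\<theta> y (\<i> *s (a *s v)) = Re a * \<theta> y (\<i> *s v) - Im a * \<theta> y v"
    using *[of "\<i> * a" v] by (simp add: vector_smult_assoc)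
  then show ?thesis
    unfolding eta_def *[of a v] by (simp add: complex_eq_iff algebra_simps add_divide_distrib diff_divide_distrib)
qed

lemma eta_zero [simp]: "y \<in> U \<Longrightarrow> eta 0 y = 0"
  using eta_scale[of y 0 0] by simp

lemma eta_diff: "y \<in> U \<Longrightarrow> eta (u - v) y = eta u y - eta v y"
  using eta_add[of y "u - v" v] by simp

lemma eta_sum: "y \<in> U \<Longrightarrow> eta (\<Sum>i\<in>I. f i) y = (\<Sum>i\<in>I. eta (f i) y)"
  by (induction I rule: infinite_finite_induct) (simp_all add: eta_add)

lemma eta_expand:
  assumes "y \<in> U"
  shows "eta v y = (\<Sum>p\<in>UNIV. v $ p * eta (axis p 1) y)"
  by (subst complex_vec_eq_sum_axis) (simp add: eta_sum eta_scale assms)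

lemma smooth_eta: "smooth_on U (eta v)"
proof -
  have "smooth_on U (\<lambda>y. of_real (\<theta> y w) :: complex)" for w
    by (rule smooth_on_bounded_linear[OF open_U bounded_linear_of_real smooth_theta])
  then show ?thesis
    unfolding eta_def[abs_def]
    by (intro smooth_on_bounded_linear[OF open_U bounded_linear_divide]
        smooth_on_add[OF open_U] smooth_on_bounded_linear[OF open_U bounded_linear_mult_right])
qed

lemma diff_eta: "x \<in> U \<Longrightarrow> eta v differentiable (at x)"
  by (rule smooth_on_imp_differentiable[OF smooth_eta])

lemma H_lee_vec:
  assumes "y \<in> U"
  shows "H v (lee_vec y) y = eta v y"
proof -
  let ?e = "\<chi> p. eta (axis p 1) y"
  have "h y *v (matrix_inv (h y) *v ?e) = ?e"
    using matrix_inv_mult(1)[OF pos_def_hermitian_invertible[OF pos_def[OF assms]]]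
    by (simp add: matrix_vector_mul_assoc)
  then have "(\<Sum>j\<in>UNIV. h y $ p $ j * (matrix_inv (h y) *v ?e) $ j) = eta (axis p 1) y" for p
    by (simp add: vec_eq_iff matrix_vector_mult_def[of "h y"])
  moreover have "H v (lee_vec y) y =
      (\<Sum>p\<in>UNIV. v $ p * (\<Sum>j\<in>UNIV. h y $ p $ j * (matrix_inv (h y) *v ?e) $ j))"
    by (simp add: H_def herm_form_def lee_vec_def sum_distrib_left mult_ac)
  ultimately show ?thesis
    by (simp add: eta_expand[OF assms, of v])
qed

lemma H_lee_vec_left: "y \<in> U \<Longrightarrow> H (lee_vec y) v y = cnj (eta v y)"
  by (metis H_cnj H_lee_vec)

lemma wirt_H_scale_left: "x \<in> U \<Longrightarrow> wirt \<sigma> w (H (a *s u) v) x = a * wirt \<sigma> w (H u v) x"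
  using wirt_mult_const[OF diff_H[of x u v], of \<sigma> w a]
  by (simp add: H_def[abs_def] herm_form_scale_left)

lemma wirt_H_scale_right: "x \<in> U \<Longrightarrow> wirt \<sigma> w (H u (a *s v)) x = cnj a * wirt \<sigma> w (H u v) x"
  using wirt_mult_const[OF diff_H[of x u v], of \<sigma> w "cnj a"]
  by (simp add: H_def[abs_def] herm_form_scale_right)

lemma H_scale: "H (a *s u) v y = a * H u v y" "H u (a *s v) y = cnj a * H u v y"
  by (simp_all add: H_def herm_form_scale_left herm_form_scale_right)

lemma wirt_eta_scale:
  assumes "x \<in> U"
  shows "wirt \<sigma> w (eta (a *s v)) x = a * wirt \<sigma> w (eta v) x"
proof -
  have "wirt \<sigma> w (eta (a *s v)) x = wirt \<sigma> w (\<lambda>y. a * eta v y) x"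
    by (rule wirt_cong_open[OF open_U assms]) (rule eta_scale)
  then show ?thesis by (simp add: wirt_mult_const[OF diff_eta[OF assms]])
qed

lemma delb_H: "x \<in> U \<Longrightarrow> delb w (H u v) x = cnj (del w (H v u) x)"
  using wirt_H_cnj[of x \<i> w u v] by simp

lemma Re_H_sym: "y \<in> U \<Longrightarrow> Re (H u v y) = Re (H v u y)"
  using arg_cong[OF H_cnj[of y u v], of Re] by simp

lemma Im_H_antisym: "y \<in> U \<Longrightarrow> Im (H u v y) = - Im (H v u y)"
  using arg_cong[OF H_cnj[of y u v], of Im] by simp

lemma fundamental_form_eq: "y \<in> U \<Longrightarrow> fundamental_form (h y) u v = - 2 * Im (H u v y)"
  using Im_H_antisym[of y u v] by (simp add: fundamental_form_def flip: H_def)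

lemma riemannian_metric_eq: "y \<in> U \<Longrightarrow> riemannian_metric (h y) u v = 2 * Re (H u v y)"
  by (simp add: riemannian_metric_def fundamental_form_eq H_scale)

section \<open>Splitting the Vaisman conditions by type\<close>

lemma frechet_derivative_fundamental_form:
  assumes "x \<in> U"
  shows "frechet_derivative (\<lambda>y. fundamental_form (h y) v w) (at x) u =
    - 2 * (Im (del u (H v w) x) - Im (del u (H w v) x))"
proof -
  have "frechet_derivative (\<lambda>y. fundamental_form (h y) v w) (at x) =
      frechet_derivative (\<lambda>y. - 2 * Im (H v w y)) (at x)"
    by (rule frechet_derivative_cong_open[OF open_U assms]) (rule fundamental_form_eq)
  moreover have "bounded_linear (\<lambda>z. - 2 * Im z)"
    by (intro bounded_linear_const_mult bounded_linear_Im)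
  note frechet_derivative_bounded_linear[OF this diff_H[OF assms, of v w]]
  ultimately show ?thesis
    by (simp add: frechet_derivative_eq_del_delb delb_H[OF assms])
qed

lemma frechet_derivative_riemannian_metric:
  assumes "x \<in> U"
  shows "frechet_derivative (\<lambda>y. riemannian_metric (h y) v w) (at x) u =
    2 * (Re (del u (H v w) x) + Re (del u (H w v) x))"
proof -
  have "frechet_derivative (\<lambda>y. riemannian_metric (h y) v w) (at x) =
      frechet_derivative (\<lambda>y. 2 * Re (H v w y)) (at x)"
    by (rule frechet_derivative_cong_open[OF open_U assms]) (rule riemannian_metric_eq)
  moreover have "bounded_linear (\<lambda>z. 2 * Re z)"
    by (intro bounded_linear_const_mult bounded_linear_Re)
  note frechet_derivative_bounded_linear[OF this diff_H[OF assms, of v w]]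
  ultimately show ?thesis
    by (simp add: frechet_derivative_eq_del_delb delb_H[OF assms])
qed

lemma frechet_derivative_theta:
  assumes "x \<in> U"
  shows "frechet_derivative (\<lambda>y. \<theta> y v) (at x) u = 2 * Re (del u (eta v) x + delb u (eta v) x)"
proof -
  have "bounded_linear (\<lambda>z. 2 * Re z)"
    by (intro bounded_linear_const_mult bounded_linear_Re)
  from frechet_derivative_bounded_linear[OF this diff_eta[OF assms, of v]] show ?thesis
    by (simp add: theta_eq frechet_derivative_eq_del_delb)
qed

text \<open>This is the (2,1)-part of \<open>lck\<close>. Read through \<open>H_conn\<close>, it
  determines the torsion of the Chern connection.\<close>

lemma del_H_swap:
  assumes x: "x \<in> U"
  shows "del u (H v w) x - del v (H u w) x = eta u x * H v w x - eta v x * H u w x"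
proof -
  define P where "P u v w = del u (H v w) x - del v (H u w) x - (eta u x * H v w x - eta v x * H u w x)"
    for u v w
  have cyc: "Im (P u v w + P v w u + P w u v) = 0" for u v w
  proof -
    have "ext_deriv2 (\<lambda>y. fundamental_form (h y)) x u v w =
        wedge12 (\<theta> x) (fundamental_form (h x)) u v w"
      by (rule lck[OF x])
    from this[unfolded ext_deriv2_def wedge12_def frechet_derivative_fundamental_form[OF x]
        fundamental_form_eq[OF x] theta_eq[of x]]
    show ?thesis
      unfolding P_def plus_complex.sel minus_complex.sel times_complex.sel
        Im_H_antisym[OF x, of v u] Im_H_antisym[OF x, of w u] Im_H_antisym[OF x, of w v]
        Re_H_sym[OF x, of v u] Re_H_sym[OF x, of w u] Re_H_sym[OF x, of w v]
      by (simp only: distrib_left right_diff_distrib)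
  qed
  \<comment> \<open>\<open>P\<close> is complex linear in the first two arguments and antilinear in the third, so multiplying two of
    them by \<open>\<i>\<close> isolates one type in the cyclic sum.\<close>
  have P_i: "P (\<i> *s u) (\<i> *s v) w = - P u v w" "P (\<i> *s u) v (\<i> *s w) = P u v w"
    "P u (\<i> *s v) (\<i> *s w) = P u v w" "P (\<i> *s u) v w = \<i> * P u v w" for u v w
    unfolding P_def
    by (simp_all add: wirt_H_scale_left[OF x] wirt_H_scale_right[OF x] wirt_scale_vector(1)[OF diff_H[OF x]]
        H_scale eta_scale[OF x] algebra_simps)
  have "Im (P u v w) = 0" for u v w
    using cyc[of u v w] cyc[of "\<i> *s u" "\<i> *s v" w] P_i(1-3) by simp
  \<comment> \<open>Linearity in the first argument makes the imaginary part at
    \<open>\<i> *s u\<close> the real part at \<open>u\<close>.\<close>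
  from this[of u v w] this[of "\<i> *s u" v w] have "P u v w = 0"
    by (simp add: P_i(4) complex_eq_iff)
  then show ?thesis by (simp add: P_def)
qed

text \<open>Since \<open>\<theta>\<close> is parallel, its derivative is
  \<open>\<theta> x (\<Gamma> x u v)\<close>, and \<open>lee_vec x\<close> is also the Riemannian
  dual of \<open>\<theta>\<close>. The Koszul combination of the three derivatives of the metric
  then eliminates \<open>\<Gamma>\<close>.\<close>

lemma koszul:
  assumes x: "x \<in> U"
  shows "2 * Re (del u (eta v) x + delb u (eta v) x) =
    Re (del u (H v (lee_vec x)) x) + Re (del u (H (lee_vec x) v) x)
    + Re (del v (H u (lee_vec x)) x) + Re (del v (H (lee_vec x) u) x)
    - Re (del (lee_vec x) (H u v) x) - Re (del (lee_vec x) (H v u) x)"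
proof -
  let ?X = "lee_vec x" and ?g = "riemannian_metric (h x)"
  have sym: "\<Gamma> x u v = \<Gamma> x v u" for u v
    using levi_civita x unfolding levi_civita_on_def by blast
  have gsym: "?g u v = ?g v u" for u v
    by (simp add: riemannian_metric_eq[OF x] Re_H_sym[OF x, of u v])
  have D: "2 * (Re (del u (H v w) x) + Re (del u (H w v) x)) = ?g (\<Gamma> x u v) w + ?g v (\<Gamma> x u w)"
    for u v w
  proof -
    have "frechet_derivative (\<lambda>y. riemannian_metric (h y) v w) (at x) u =
        ?g (\<Gamma> x u v) w + ?g v (\<Gamma> x u w)"
      using levi_civita x unfolding levi_civita_on_def by blast
    then show ?thesis
      by (simp only: frechet_derivative_riemannian_metric[OF x])
  qed
  have "frechet_derivative (\<lambda>y. \<theta> y v) (at x) u - \<theta> x (\<Gamma> x u v) = 0"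
    using parallel x unfolding parallel_on_def by blast
  then have "2 * Re (del u (eta v) x + delb u (eta v) x) = \<theta> x (\<Gamma> x u v)"
    by (simp add: frechet_derivative_theta[OF x])
  also have "\<dots> = ?g (\<Gamma> x u v) ?X"
    by (simp add: theta_eq riemannian_metric_eq[OF x] H_lee_vec[OF x])
  finally have "2 * Re (del u (eta v) x + delb u (eta v) x) = ?g (\<Gamma> x u v) ?X" .
  moreover have "?g (\<Gamma> x v u) ?X = ?g (\<Gamma> x u v) ?X" "?g u (\<Gamma> x ?X v) = ?g u (\<Gamma> x v ?X)"
    by (simp_all only: sym[of v u] sym[of ?X v])
  moreover have "?g (\<Gamma> x ?X u) v = ?g v (\<Gamma> x u ?X)"
    unfolding sym[of ?X u] by (rule gsym)
  ultimately show ?thesis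
    using D[of u v ?X] D[of v u ?X] D[of ?X u v] by (simp only: distrib_left)
qed

text \<open>The Koszul identity is the real part of a sum of two errors, \<open>Q\<close> and
  \<open>S\<close>, one for each claim. They have different types in \<open>u\<close>, so they
  vanish separately.\<close>

lemma wirt_eta:
  assumes x: "x \<in> U"
  shows del_eta: "del u (eta v) x = del u (H v (lee_vec x)) x"
    and delb_eta: "delb u (eta v) x = beta v u x"
proof -
  let ?X = "lee_vec x" and ?s = "eta (lee_vec x) x"
  define Q where "Q u v = del u (eta v) x - del u (H v ?X) x" for u v
  define S where "S u v = delb u (eta v) x - beta v u x" for u v
  have Re: "Re (Q u v + S u v) = 0" for u v
  proof -
    have s: "Im ?s = 0"
      using Im_H_antisym[OF x, of ?X ?X] by (simp add: H_lee_vec[OF x])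
    \<comment> \<open>The first two swaps have right sides whose real parts add up to twice that of
      \<open>beta v u x\<close>; the third identifies the two remaining derivatives of the
      metric.\<close>
    have 1: "del u (H ?X v) x - del ?X (H u v) x = eta u x * cnj (eta v x) - ?s * H u v x"
      and 2: "del v (H ?X u) x - del ?X (H v u) x = eta v x * cnj (eta u x) - ?s * H v u x"
      and 3: "del v (H u ?X) x - del u (H v ?X) x = 0"
      using del_H_swap[OF x, of u ?X v] del_H_swap[OF x, of v ?X u] del_H_swap[OF x, of v u ?X]
      by (simp_all add: H_lee_vec[OF x] H_lee_vec_left[OF x])
    show ?thesis
      using koszul[OF x, of u v] arg_cong[OF 1, of Re] arg_cong[OF 2, of Re] arg_cong[OF 3, of Re] s Re_H_sym[OF x, of u v]
      by (simp add: Q_def S_def beta_def algebra_simps)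
  qed
  have Q_i: "Q (\<i> *s u) v = \<i> * Q u v" "Q u (\<i> *s v) = \<i> * Q u v"
    and S_i: "S (\<i> *s u) v = - \<i> * S u v" "S u (\<i> *s v) = \<i> * S u v" for u v
    unfolding Q_def S_def beta_def
    by (simp_all add: wirt_H_scale_left[OF x] wirt_scale_vector[OF diff_H[OF x]]
        wirt_scale_vector[OF diff_eta[OF x]] wirt_eta_scale[OF x] H_scale eta_scale[OF x] algebra_simps)
  \<comment> \<open>Multiplying \<open>u\<close> by \<open>\<i>\<close> multiplies \<open>Q\<close>
    by \<open>\<i>\<close> but \<open>S\<close> by \<open>- \<i>\<close>, while \<open>v\<close>
    enters both linearly. The four choices therefore isolate all real and imaginary parts.\<close>
  have "Q u v = 0 \<and> S u v = 0"
    using Re[of u v] Re[of "\<i> *s u" "\<i> *s v"] Re[of "\<i> *s u" v] Re[of u "\<i> *s v"]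
    by (simp add: Q_i S_i complex_eq_iff)
  then show "del u (eta v) x = del u (H v ?X) x" "delb u (eta v) x = beta v u x"
    by (simp_all add: Q_def S_def)
qed

lemma H_add: "H (u + u') v y = H u v y + H u' v y" "H u (v + v') y = H u v y + H u v' y"
  by (simp_all add: H_def herm_form_add_left herm_form_add_right)

lemma H_diff_left: "H (u - u') v y = H u v y - H u' v y"
  by (simp add: H_def herm_form_diff_left)

lemma H_cancel_right: "y \<in> U \<Longrightarrow> (\<And>w. H u w y = H v w y) \<Longrightarrow> u = v"
  unfolding H_def by (rule herm_form_cancel_right[OF pos_def])

lemma H_eq_0_iff: "y \<in> U \<Longrightarrow> H v v y = 0 \<longleftrightarrow> v = 0"
  unfolding H_def by (rule herm_form_eq_0_iff[OF pos_def])

lemma lee_norm_real: "y \<in> U \<Longrightarrow> cnj (eta (lee_vec y) y) = eta (lee_vec y) y"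
  by (metis H_lee_vec H_lee_vec_left)

lemma beta_cnj: "y \<in> U \<Longrightarrow> cnj (beta u v y) = beta v u y"
  by (simp add: beta_def H_cnj lee_norm_real)

lemma beta_expand_left:
  assumes "y \<in> U"
  shows "beta u v y = (\<Sum>p\<in>UNIV. u $ p * beta (axis p 1) v y)"
proof -
  have "H u v y = (\<Sum>p\<in>UNIV. u $ p * H (axis p 1) v y)"
    unfolding H_def by (rule herm_form_expand_left)
  then show ?thesis
    unfolding beta_def eta_expand[OF assms, of u]
    by (simp add: sum_distrib_left sum_distrib_right algebra_simps sum_subtractf)
qed

section \<open>Integrability conditions: curvature applied to the Lee form\<close>

lemma del_eta_conn: "y \<in> U \<Longrightarrow> del u (eta v) y = eta (conn u v y) y"
  by (simp add: del_eta H_conn[symmetric] H_lee_vec)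

text \<open>For a fixed nonzero \<open>v\<close>, \<open>delb_eta\<close> can be solved for s. This
  exhibits s as a quotient of differentiable functions without differentiating
  \<open>lee_vec\<close>.\<close>

lemma diff_lee_norm:
  assumes x: "x \<in> U"
  shows "(\<lambda>y. eta (lee_vec y) y) differentiable (at x)"
proof -
  define v :: "complex^'n" where "v = axis undefined 1"
  have v: "v \<noteq> 0" by (simp add: v_def axis_eq_0_iff)
  have "delb v (eta v) y = eta v y * cnj (eta v y) - eta (lee_vec y) y * H v v y" if "y \<in> U" for y
    using delb_eta[OF that, of v v] by (simp add: beta_def)
  then have "(eta v y * cnj (eta v y) - delb v (eta v) y) / H v v y = eta (lee_vec y) y"
    if "y \<in> U" for y
    using that H_eq_0_iff[OF that, of v] v by simp
  moreover have "(\<lambda>y. (eta v y * cnj (eta v y) - delb v (eta v) y) / H v v y) differentiable (at x)"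
  proof -
    have "H v v x \<noteq> 0"
      using H_eq_0_iff[OF x, of v] v by simp
    then show ?thesis
      by (intro differentiable_divide differentiable_diff differentiable_mult differentiable_cnj
          diff_H[OF x] diff_eta[OF x]
          smooth_on_imp_differentiable[OF smooth_on_wirt[OF open_U smooth_eta] x])
  qed
  ultimately show ?thesis
    by (rule differentiable_cong_open[OF open_U x])
qed

lemma del_beta:
  assumes x: "x \<in> U"
  shows "del u (beta v w) x = eta (conn u v x) x * cnj (eta w x) + eta v x * beta u w x
    - del u (\<lambda>y. eta (lee_vec y) y) x * H v w x - eta (lee_vec x) x * H (conn u v x) w x"
proof -
  have c: "(\<lambda>y. cnj (eta w y)) differentiable (at x)"
    by (rule differentiable_cnj[OF diff_eta[OF x]])
  have "del u (beta v w) x =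
      del u (\<lambda>y. eta v y * cnj (eta w y)) x - del u (\<lambda>y. eta (lee_vec y) y * H v w y) x"
    unfolding beta_def[abs_def]
    by (rule wirt_diff) (intro differentiable_mult diff_eta[OF x] diff_H[OF x] diff_lee_norm[OF x] c)+
  also have "del u (\<lambda>y. eta v y * cnj (eta w y)) x =
      eta (conn u v x) x * cnj (eta w x) + eta v x * beta u w x"
    by (simp add: wirt_mult[OF diff_eta[OF x] c] wirt_cnj[OF diff_eta[OF x]] del_eta_conn[OF x]
        delb_eta[OF x] beta_cnj[OF x])
  also have "del u (\<lambda>y. eta (lee_vec y) y * H v w y) x =
      del u (\<lambda>y. eta (lee_vec y) y) x * H v w x + eta (lee_vec x) x * H (conn u v x) w x"
    by (simp add: wirt_mult[OF diff_lee_norm[OF x] diff_H[OF x]] H_conn[OF x])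
  finally show ?thesis by simp
qed

text \<open>Both orders of \<open>del u\<close> and \<open>delb w\<close> on \<open>eta v\<close>
  are computed, one through \<open>del_eta_conn\<close> and the other through
  \<open>delb_eta\<close>. The terms containing \<open>conn u v x\<close> cancel, leaving the
  curvature and the derivative of s.\<close>

lemma eta_dbar_conn_aux:
  assumes x: "x \<in> U"
  shows "eta (dbar_conn w u v x) x =
    eta v x * beta u w x - del u (\<lambda>y. eta (lee_vec y) y) x * H v w x"
proof -
  have "delb w (del u (eta v)) x = delb w (\<lambda>y. \<Sum>p\<in>UNIV. conn u v y $ p * eta (axis p 1) y) x"
    by (rule wirt_cong_open[OF open_U x]) (simp only: del_eta_conn, rule eta_expand)
  also have "\<dots> = (\<Sum>p\<in>UNIV. dbar_conn w u v x $ p * eta (axis p 1) x + conn u v x $ p * beta (axis p 1) w x)"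
    by (simp add: wirt_sum wirt_mult diff_conn[OF x] diff_eta[OF x] dbar_conn_def delb_eta[OF x])
  also have "\<dots> = eta (dbar_conn w u v x) x + beta (conn u v x) w x"
    by (simp add: sum.distrib eta_expand[OF x, of "dbar_conn w u v x"] beta_expand_left[OF x, of "conn u v x"])
  finally have 1: "delb w (del u (eta v)) x = eta (dbar_conn w u v x) x + beta (conn u v x) w x" .
  have "delb w (del u (eta v)) x = del u (delb w (eta v)) x"
    by (rule wirt_commute[OF open_U x smooth_eta])
  also have "\<dots> = del u (beta v w) x"
    by (rule wirt_cong_open[OF open_U x]) (rule delb_eta)
  finally show ?thesis
    unfolding 1 del_beta[OF x] by (simp add: beta_def algebra_simps)
qed

lemma conn_torsion:
  assumes "y \<in> U"
  shows "conn u v y - conn v u y = eta u y *s v - eta v y *s u"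
proof (rule H_cancel_right[OF assms])
  show "H (conn u v y - conn v u y) w y = H (eta u y *s v - eta v y *s u) w y" for w
    using del_H_swap[OF assms, of u v w] by (simp add: H_diff_left H_conn[OF assms] H_scale)
qed

text \<open>Applying \<open>delb w\<close> to \<open>conn_torsion\<close> gives this first Bianchi
  identity with torsion, because \<open>delb_eta\<close> replaces the derivatives of
  \<open>eta\<close> by \<open>beta\<close>.\<close>

lemma dbar_conn_torsion:
  assumes x: "x \<in> U"
  shows "dbar_conn w u v x - dbar_conn w v u x = beta u w x *s v - beta v w x *s u"
proof -
  have "dbar_conn w u v x $ p - dbar_conn w v u x $ p = beta u w x * v $ p - beta v w x * u $ p" for p
  proof -
    have "dbar_conn w u v x $ p - dbar_conn w v u x $ p = delb w (\<lambda>y. conn u v y $ p - conn v u y $ p) x"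
      by (simp add: dbar_conn_def wirt_diff[OF diff_conn[OF x] diff_conn[OF x]])
    also have "\<dots> = delb w (\<lambda>y. v $ p * eta u y - u $ p * eta v y) x"
    proof (rule wirt_cong_open[OF open_U x])
      show "conn u v y $ p - conn v u y $ p = v $ p * eta u y - u $ p * eta v y" if "y \<in> U" for y
        using arg_cong[OF conn_torsion[OF that, of u v], of "\<lambda>z. z $ p"] by (simp add: mult.commute)
    qed
    also have "\<dots> = v $ p * beta u w x - u $ p * beta v w x"
      by (subst wirt_diff) (simp_all add: wirt_mult_const diff_eta[OF x] delb_eta[OF x])
    finally show ?thesis by (simp add: mult.commute)
  qed
  then show ?thesis by (simp add: vec_eq_iff)
qed

lemma del_lee_norm:
  assumes card: "CARD('n) \<ge> 2" and x: "x \<in> U"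
  shows "del u (\<lambda>y. eta (lee_vec y) y) x = 0"
proof (cases "u = 0")
  case True
  then show ?thesis by (simp add: diff_lee_norm[OF x])
next
  case False
  let ?\<tau> = "\<lambda>u. del u (\<lambda>y. eta (lee_vec y) y) x"
  \<comment> \<open>Obtained by applying \<open>\<eta>\<close> to the torsion formula; in dimension at least 2 it forces \<open>?\<tau> = 0\<close>.\<close>
  have swap: "?\<tau> u *s v = ?\<tau> v *s u" for u v
  proof (rule H_cancel_right[OF x])
    fix w
    have "eta (dbar_conn w u v x) x - eta (dbar_conn w v u x) x = beta u w x * eta v x - beta v w x * eta u x"
      using arg_cong[OF dbar_conn_torsion[OF x, of w u v], of "\<lambda>z. eta z x"]
      by (simp add: eta_diff[OF x] eta_scale[OF x])
    then show "H (?\<tau> u *s v) w x = H (?\<tau> v *s u) w x"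
      by (simp add: eta_dbar_conn_aux[OF x] H_scale algebra_simps)
  qed
  obtain i where i: "u $ i \<noteq> 0"
    using False by (auto simp: vec_eq_iff)
  obtain j where j: "j \<noteq> i"
    using exists_other_index[OF card] by blast
  \<comment> \<open>Component \<open>i\<close> of \<open>axis j 1\<close> is zero while that of
    \<open>u\<close> is not. Component \<open>j\<close> of the same identity then gives the claim
    for \<open>u\<close>.\<close>
  have "?\<tau> (axis j 1) = 0"
    using arg_cong[OF swap[of u "axis j 1"], of "\<lambda>z. z $ i"] i j by (simp add: axis_def)
  then show ?thesis
    using arg_cong[OF swap[of u "axis j 1"], of "\<lambda>z. z $ j"] by simp
qed

lemma eta_dbar_conn:
  assumes "CARD('n) \<ge> 2" "x \<in> U"
  shows "eta (dbar_conn w u v x) x = eta v x * beta u w x"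
  by (simp add: eta_dbar_conn_aux del_lee_norm assms)

section \<open>Vanishing of the Lee form at a point\<close>

lemma exists_eta_kernel:
  assumes card: "CARD('n) \<ge> 2" and x: "x \<in> U"
  obtains z where "z \<noteq> 0" "eta z x = 0"
proof -
  obtain i j :: 'n where ij: "i \<noteq> j"
    using exists_other_index[OF card] by blast
  \<comment> \<open>This combination of two basis vectors always lies in the kernel, but it is zero
    if \<open>eta\<close> vanishes on both; hence the case distinction, with \<open>axis i 1\<close>
    as the other witness.\<close>
  define z where "z = eta (axis j 1) x *s axis i 1 - eta (axis i 1) x *s axis j (1 :: complex)"
  show thesis
  proof (cases "eta (axis i 1) x = 0")
    case True
    then show thesis using that[of "axis i 1"] by (simp add: axis_eq_0_iff)
  next
    case False
    then have "z $ j \<noteq> 0" using ij by (simp add: z_def axis_def)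
    then have "z \<noteq> 0" by auto
    moreover have "eta z x = 0"
      by (simp add: z_def eta_diff[OF x] eta_scale[OF x])
    ultimately show thesis using that by blast
  qed
qed

lemma eta_eq_0:
  assumes card: "CARD('n) \<ge> 2" and x: "x \<in> U"
    and const: "\<And>X. X \<noteq> 0 \<Longrightarrow> hol_sect_curv h x X = c"
  shows "eta v x = 0"
proof -
  let ?X = "lee_vec x" and ?s = "eta (lee_vec x) x"
  \<comment> \<open>Up to sign, \<open>E\<close> is the curvature of the local Kaehler metrics conformal to \<open>h\<close>; those are
    locally cones with radial direction \<open>lee_vec\<close>, which lies in the kernel of the curvature.\<close>
  define E where "E u w v z = H (dbar_conn w u v x) z x - H v z x * beta u w x" for u w v z
  \<comment> \<open>The torsion terms of the Bianchi identity are exactly those removed by the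
    \<open>beta\<close> correction in \<open>E\<close>.\<close>
  have sym: "E u w v z = E v w u z" for u w v z
    using arg_cong[OF dbar_conn_torsion[OF x, of w u v], of "\<lambda>y. H y z x"]
    by (simp add: E_def H_diff_left H_scale algebra_simps)
  have herm: "E w u z v = cnj (E u w v z)" for u w v z
    unfolding E_def complex_cnj_diff complex_cnj_mult dbar_conn_hermitian[OF x] H_cnj[OF x, of v z] beta_cnj[OF x]
    by (rule refl)
  \<comment> \<open>Pairing with \<open>?X\<close> is \<open>eta\<close>, and
    \<open>eta_dbar_conn\<close> evaluates it to the subtracted term.\<close>
  have X4: "E u w v ?X = 0" for u w v
    by (simp add: E_def H_lee_vec[OF x] eta_dbar_conn[OF card x])
  have add4: "E u w v (z + z') = E u w v z + E u w v z'" for u w v z z'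
    by (simp add: E_def H_add algebra_simps)
  \<comment> \<open>Vanishing at \<open>?X\<close> and additivity now travel from the fourth
    argument to the third by \<open>herm\<close>, to the first by \<open>sym\<close>, and to the
    second by \<open>herm\<close> again.\<close>
  have X3: "E u w ?X z = 0" for u w z
    using herm[of u w ?X z] X4 by simp
  have add3: "E u w (v + v') z = E u w v z + E u w v' z" for u w v v' z
    using herm[of u w _ z] add4 by simp
  have X1: "E ?X w v z = 0" for w v z
    using sym X3 by simp
  have add1: "E (u + u') w v z = E u w v z + E u' w v z" for u u' w v z
    using sym add3 by metis
  have X2: "E u ?X v z = 0" for u v z
    using herm[of u ?X v z] X1 by simp
  have add2: "E u (w + w') v z = E u w v z + E u w' v z" for u w w' v z
    using herm[of u _ v z] add1 by simp
  have E_diag: "E y y y y = - c * (H y y x)\<^sup>2 - H y y x * beta y y x" if "y \<noteq> 0" for y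
  proof -
    have "- H (dbar_conn y y y x) y x = c * (H y y x)\<^sup>2"
      using const[OF that] H_eq_0_iff[OF x, of y] that
      by (simp add: hol_sect_curv_eq[OF x] field_simps)
    then show ?thesis unfolding E_def by algebra
  qed
  have "?X = 0"
  proof (rule ccontr)
    assume X: "?X \<noteq> 0"
    have s: "?s \<noteq> 0" "H ?X ?X x = ?s" "cnj ?s = ?s"
      using H_eq_0_iff[OF x, of ?X] X by (simp_all add: H_lee_vec[OF x] lee_norm_real[OF x])
    \<comment> \<open>Both terms of \<open>beta\<close> equal the square of \<open>?s\<close> here,
      so on the diagonal at \<open>?X\<close> only the term with \<open>c\<close> is left.\<close>
    have "beta ?X ?X x = 0"
      by (simp add: beta_def s)
    then have c: "c = 0"
      using E_diag[OF X] X4 s by simp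
    obtain z where z: "z \<noteq> 0" "eta z x = 0"
      using exists_eta_kernel[OF card x] .
    define n where "n = H z z x"
    have n: "n \<noteq> 0" using z H_eq_0_iff[OF x, of z] by (simp add: n_def)
    have Hz: "H z ?X x = 0" "H ?X z x = 0"
      using z by (simp_all add: H_lee_vec[OF x] H_lee_vec_left[OF x])
    have ne: "?X + z \<noteq> 0"
      using s z by (metis add_eq_0_iff add.right_neutral eta_add[OF x] eta_zero[OF x])
    \<comment> \<open>Every mixed term has an argument \<open>?X\<close>. With \<open>c = 0\<close>,
      \<open>E_diag\<close> turns this equality into (s + n) s n = n s n, whose difference is s
      squared times n.\<close>
    have "E (?X + z) (?X + z) (?X + z) (?X + z) = E z z z z"
      by (simp add: add1 add2 add3 add4 X1 X2 X3 X4)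
    moreover have "H (?X + z) (?X + z) x = ?s + n"
      by (simp add: H_add Hz s n_def)
    moreover have "beta (?X + z) (?X + z) x = - ?s * n" "beta z z x = - ?s * n"
      by (simp_all add: beta_def eta_add[OF x] z H_add Hz s n_def algebra_simps)
    ultimately have "?s * n = 0"
      using E_diag[OF ne] E_diag[OF z(1)] by (auto simp: c n_def)
    then show False using s n by simp
  qed
  then show ?thesis
    using H_lee_vec[OF x, of v] by (simp add: H_def)
qed

end

section \<open>From single charts to the manifold\<close>

theorem corollary1p3:
  fixes A :: "('a::{t2_space, second_countable_topology}, 'n::finite) chart set"
    and h :: "('a, 'n) chart \<Rightarrow> complex^'n \<Rightarrow> complex^'n^'n"
    and c :: "'a \<Rightarrow> real"
  assumes "complex_atlas A"
    and "CARD('n) \<ge> 2"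
    and "compact (UNIV :: 'a set)"
    and "hermitian_metric A h"
    and "vaisman A h"
    and "\<And>p. c p \<le> 0"
    and "\<And>C p X. C \<in> A \<Longrightarrow> p \<in> fst C \<Longrightarrow> X \<noteq> 0 \<Longrightarrow>
           hol_sect_curv (h C) (snd C p) X = of_real (c p)"
  shows "kahler A h"
proof -
  obtain \<theta> where \<theta>: "lee_form A h \<theta>" and lc: "\<And>C. C \<in> A \<Longrightarrow>
      \<exists>\<Gamma>. levi_civita_on (coord_range C) (\<lambda>y. riemannian_metric (h C y)) \<Gamma> \<and>
          parallel_on (coord_range C) \<Gamma> (\<theta> C)"
    using assms(5) unfolding vaisman_def by blast
  have "ext_deriv2 (\<lambda>y. fundamental_form (h C y)) x u v w = 0"
    if C: "C \<in> A" and x: "x \<in> coord_range C" for C x u v w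
  proof -
    obtain \<Gamma> where \<Gamma>: "levi_civita_on (coord_range C) (\<lambda>y. riemannian_metric (h C y)) \<Gamma>"
      "parallel_on (coord_range C) \<Gamma> (\<theta> C)"
      using lc[OF C] by blast
    have lck: "ext_deriv2 (\<lambda>y. fundamental_form (h C y)) y u v w =
        wedge12 (\<theta> C y) (fundamental_form (h C y)) u v w" if "y \<in> coord_range C" for y u v w
      using \<theta> C that unfolding lee_form_def by blast
    have one_form: "one_form A \<theta>"
      using \<theta> unfolding lee_form_def closed_one_form_def by blast
    interpret vaisman_chart "coord_range C" "h C" "\<theta> C" \<Gamma>
    proof (intro vaisman_chart.intro hermitian_chart.intro vaisman_chart_axioms.intro)
      show "open (coord_range C)"
        using assms(1) C unfolding complex_atlas_def by blast
      show "smooth_on (coord_range C) (h C)"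
        using assms(4) C unfolding hermitian_metric_def by blast
      show "pos_def_hermitian (h C y)" if "y \<in> coord_range C" for y
        using assms(4) C that unfolding hermitian_metric_def by blast
      show "linear (\<theta> C y)" if "y \<in> coord_range C" for y
        using one_form C that unfolding one_form_def by blast
      show "smooth_on (coord_range C) (\<lambda>x. \<theta> C x v)" for v
        using one_form C unfolding one_form_def by blast
      show "ext_deriv2 (\<lambda>y. fundamental_form (h C y)) y u v w =
          wedge12 (\<theta> C y) (fundamental_form (h C y)) u v w" if "y \<in> coord_range C" for y u v w
        using that by (rule lck)
    qed (rule \<Gamma>)+
    obtain p where p: "p \<in> fst C" "x = snd C p"
      using x unfolding coord_range_def by blast
    have "eta v x = 0" for v
    \<comment> \<open>The pointwise lemma asks for a curvature constant at \<open>x\<close> only, so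
      the value of \<open>c\<close> at the point \<open>p\<close> over \<open>x\<close>
      serves.\<close>
    proof (rule eta_eq_0[OF assms(2) x])
      show "hol_sect_curv (h C) x X = of_real (c p)" if "X \<noteq> 0" for X
        using assms(7)[OF C p(1) that] p(2) by simp
    qed
    \<comment> \<open>The Lee form is twice the real part of \<open>eta\<close>, so it vanishes at
      \<open>x\<close>, and with it the wedge product that equals d\<omega>.\<close>
    then show ?thesis
      by (simp add: lck[OF x] wedge12_def theta_eq)
  qed
  then show ?thesis
    unfolding kahler_def by blast
qed

end
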